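(* Let $f:\mathbb{R}\times\mathbb{R}^m\to\mathbb{R}$ be convex with at most quadratic growth and let $g:\mathbb{R}^n\to\mathbb{R}$ be convex and Lipschitz continuous. Suppose that: (i) $y\mapsto f(x,y)$ is uniformly semiconcave, i.e. there exists $M>0$ such that $f(x,y+\xi)\le f(x,y)+\xi\cdot D_yf(x,y)+\frac12M\|\xi\|^2$ for all $(x,y)\in\mathbb{R}\times\mathbb{R}^m$ and $\xi\in\mathbb{R}^m$; (ii) the control set $\mathbb{A}$ is convex and the map $(A,y)\mapsto f(g(X^A_T),y)$ on $\mathcal{A}\times\mathbb{R}^m$ is jointly convex, almost surely. Let $V(y):=\inf_{A\in\mathcal{A}}\mathbb{E}[f(g(X^A_T),y)]$. Fix $y\in\mathbb{R}^m$ and assume there exists $A\in\mathcal{A}$ such that $V(y)=\mathbb{E}[f(g(X^A_T),y)]$. Then $V$ is differentiable at $y$ and its gradient is $$DV(y)=\mathbb{E}\left[D_yf(g(X^A_T),y)\right].$$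
   Context: Setting. Fix $T>0$. $(\Omega,\mathcal{F},\mathbb{P})$ is a probability space supporting a standard $d$-dimensional Brownian motion $W$ with filtration $\{\mathcal{F}_t\}_{0\le t\le T}$ satisfying the usual conditions. $\mathbb{A}$ is a compact subset of a finite-dimensional Euclidean space; $\mathcal{A}$ is the set of all $\mathcal{F}_t$-progressively measurable processes valued in $\mathbb{A}$ almost surely. The functions $\mu:\mathbb{R}^n\times\mathbb{A}\to\mathbb{R}^n$ and $\sigma:\mathbb{R}^n\times\mathbb{A}\to\mathbb{R}^{n\times d}$ are continuous and for some $K>0$ satisfy $\|\mu(x,a)-\mu(x',a)\|+\|\sigma(x,a)-\sigma(x',a)\|\le K\|x-x'\|$ and $\|\mu(x,a)\|+\|\sigma(x,a)\|\le K(1+\|x\|+\|a\|)$ for all $x,x'\in\mathbb{R}^n$, $a\in\mathbb{A}$. For $A\in\mathcal{A}$, $X^A$ is the unique strong solution of $dX^A_t=\mu(X^A_t,A_t)\,dt+\sigma(X^A_t,A_t)\,dW_t$, $X^A_0=\bm{x}_0$, with $\bm{x}_0\in\mathbb{R}^n$ fixed. Convexity of $f$ together with uniform semiconcavity makes $y\mapsto f(x,y)$ continuously differentiable for each $x$; $D_yf$ denotes this gradient. Joint convexity, almost surely, means: for all $A,A'\in\mathcal{A}$, $y,y'\in\mathbb{R}^m$, $\theta\in[0,1]$, almost surely $f(g(X^{\theta A+(1-\theta)A'}_T),\theta y+(1-\theta)y')\le\theta f(g(X^A_T),y)+(1-\theta)f(g(X^{A'}_T),y')$. *)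

theory Defs
  imports "HOL-Probability.Probability"
begin

text \<open>
  Processes on the horizon \<open>[0,T]\<close> are functions \<open>real \<Rightarrow> 'w \<Rightarrow> _\<close>, and filtrations are functions
  \<open>real \<Rightarrow> 'w measure\<close>; every condition below constrains times in \<open>[0,T]\<close> only, so values at other
  times are irrelevant.
\<close>

definition usual_filtration :: "'w measure \<Rightarrow> real \<Rightarrow> (real \<Rightarrow> 'w measure) \<Rightarrow> bool" where
  "usual_filtration M T F \<longleftrightarrow>
     (\<forall>t\<in>{0..T}. space (F t) = space M \<and> sets (F t) \<subseteq> sets M) \<and>
     (\<forall>s\<in>{0..T}. \<forall>t\<in>{s..T}. sets (F s) \<subseteq> sets (F t)) \<and>
     (\<forall>t\<in>{0..<T}. sets (F t) = (\<Inter>s\<in>{t<..T}. sets (F s))) \<and>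
     (\<forall>N\<in>null_sets M. \<forall>B. B \<subseteq> N \<longrightarrow> B \<in> sets (F 0))"

text \<open>
  The components of the increment \<open>W t - W s\<close> are independent centred normal variables with
  variance \<open>t - s\<close> (\<open>normal_density\<close> takes the standard deviation), and the increment as a
  vector is independent of \<open>F s\<close>.
\<close>

definition brownian_motion ::
  "'w measure \<Rightarrow> real \<Rightarrow> (real \<Rightarrow> 'w measure) \<Rightarrow> (real \<Rightarrow> 'w \<Rightarrow> real^'d) \<Rightarrow> bool" where
  "brownian_motion M T F W \<longleftrightarrow>
     (\<forall>t\<in>{0..T}. W t \<in> borel_measurable (F t)) \<and>
     (AE \<omega> in M. W 0 \<omega> = 0) \<and>
     (AE \<omega> in M. continuous_on {0..T} (\<lambda>t. W t \<omega>)) \<and>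
     (\<forall>s t. 0 \<le> s \<and> s < t \<and> t \<le> T \<longrightarrow>
        prob_space.indep_vars M (\<lambda>_. borel) (\<lambda>i \<omega>. (W t \<omega> - W s \<omega>) $ i) UNIV \<and>
        (\<forall>i. distributed M lborel (\<lambda>\<omega>. (W t \<omega> - W s \<omega>) $ i)
               (\<lambda>x. ennreal (normal_density 0 (sqrt (t - s)) x))) \<and>
        prob_space.indep_set M (sets (F s))
          (sets (vimage_algebra (space M) (\<lambda>\<omega>. W t \<omega> - W s \<omega>) borel)))"

definition prog_measurable ::
  "real \<Rightarrow> (real \<Rightarrow> 'w measure) \<Rightarrow> (real \<Rightarrow> 'w \<Rightarrow> 'b::topological_space) \<Rightarrow> bool" where
  "prog_measurable T F H \<longleftrightarrow>
     (\<forall>t\<in>{0..T}. (\<lambda>(s, \<omega>). H s \<omega>) \<in> borel_measurable (restrict_space borel {0..t} \<Otimes>\<^sub>M F t))"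

definition controls ::
  "'w measure \<Rightarrow> real \<Rightarrow> (real \<Rightarrow> 'w measure) \<Rightarrow> 'e::euclidean_space set \<Rightarrow> (real \<Rightarrow> 'w \<Rightarrow> 'e) set" where
  "controls M T F S = {A. prog_measurable T F A \<and> (AE \<omega> in M. \<forall>t\<in>{0..T}. A t \<omega> \<in> S)}"

text \<open>
  A simple integrand is given by data \<open>(k, p, \<xi>)\<close> with \<open>0 \<le> p 0 \<le> \<dots> \<le> p k \<le> T\<close>, representing the
  process that equals \<open>\<xi> i\<close> on \<open>(p i, p (i+1)]\<close> for \<open>i < k\<close>, and 0 elsewhere.
\<close>

type_synonym ('w, 'b) simple_data = "nat \<times> (nat \<Rightarrow> real) \<times> (nat \<Rightarrow> 'w \<Rightarrow> 'b)"

definition simple_integrand ::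
  "'w measure \<Rightarrow> real \<Rightarrow> (real \<Rightarrow> 'w measure) \<Rightarrow> ('w, 'b::real_normed_vector) simple_data \<Rightarrow> bool" where
  "simple_integrand M T F = (\<lambda>(k, p, \<xi>). \<forall>i<k.
     0 \<le> p i \<and> p i \<le> p (Suc i) \<and> p (Suc i) \<le> T \<and>
     \<xi> i \<in> borel_measurable (F (p i)) \<and> (\<exists>B. \<forall>\<omega>\<in>space M. norm (\<xi> i \<omega>) \<le> B))"

definition simple_process ::
  "('w, 'b::real_normed_vector) simple_data \<Rightarrow> real \<Rightarrow> 'w \<Rightarrow> 'b" where
  "simple_process = (\<lambda>(k, p, \<xi>) t \<omega>. \<Sum>i<k. indicat_real {p i<..p (Suc i)} t *\<^sub>R \<xi> i \<omega>)"

definition simple_integral ::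
  "(real \<Rightarrow> 'w \<Rightarrow> real^'d) \<Rightarrow> ('w, real^'d^'n) simple_data \<Rightarrow> real \<Rightarrow> 'w \<Rightarrow> real^'n" where
  "simple_integral W = (\<lambda>(k, p, \<xi>) t \<omega>.
     \<Sum>i<k. \<xi> i \<omega> *v (W (min t (p (Suc i))) \<omega> - W (min t (p i)) \<omega>))"

text \<open>
  The probability of the events \<open>E n\<close> tends to 0. Measurable covers are used so that events that
  are not measurable are not silently given probability 0.
\<close>

definition vanishing_prob :: "'w measure \<Rightarrow> (nat \<Rightarrow> 'w set) \<Rightarrow> bool" where
  "vanishing_prob M E \<longleftrightarrow>
     (\<exists>S. (\<forall>n. S n \<in> sets M \<and> E n \<subseteq> S n) \<and> (\<lambda>n. measure M (S n)) \<longlonglongrightarrow> 0)"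

text \<open>
  Integrands of the Ito integral: progressively measurable (up to indistinguishability) with almost
  surely square integrable paths.
\<close>

definition ito_integrand ::
  "'w measure \<Rightarrow> real \<Rightarrow> (real \<Rightarrow> 'w measure) \<Rightarrow> (real \<Rightarrow> 'w \<Rightarrow> 'b::real_normed_vector) \<Rightarrow> bool" where
  "ito_integrand M T F H \<longleftrightarrow>
     (\<exists>H'. prog_measurable T F H' \<and> (AE \<omega> in M. \<forall>t\<in>{0..T}. H t \<omega> = H' t \<omega>)) \<and>
     (AE \<omega> in M. (\<integral>\<^sup>+t\<in>{0..T}. ennreal ((norm (H t \<omega>))\<^sup>2) \<partial>lborel) < \<infinity>)"

text \<open>
  \<open>Y\<close> is (a version of) the stochastic integral process \<open>\<integral>\<^sub>0\<^sup>t H dW\<close>: there are simple processes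
  \<open>D n\<close> with \<open>\<integral>\<^sub>0\<^sup>T \<parallel>D n - H\<parallel>\<^sup>2 dt \<longlonglongrightarrow> 0\<close> in probability whose elementary integrals converge to \<open>Y\<close>
  uniformly on \<open>[0,T]\<close> in probability. The norm on matrices is the Frobenius norm.
\<close>

definition ito_integral ::
  "'w measure \<Rightarrow> real \<Rightarrow> (real \<Rightarrow> 'w measure) \<Rightarrow> (real \<Rightarrow> 'w \<Rightarrow> real^'d) \<Rightarrow>
   (real \<Rightarrow> 'w \<Rightarrow> real^'d^'n) \<Rightarrow> (real \<Rightarrow> 'w \<Rightarrow> real^'n) \<Rightarrow> bool" where
  "ito_integral M T F W H Y \<longleftrightarrow> ito_integrand M T F H \<and>
     (\<exists>D. (\<forall>n. simple_integrand M T F (D n)) \<and>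
       (\<forall>\<epsilon>>0. vanishing_prob M (\<lambda>n. {\<omega>\<in>space M.
          (\<integral>\<^sup>+t\<in>{0..T}. ennreal ((norm (simple_process (D n) t \<omega> - H t \<omega>))\<^sup>2) \<partial>lborel) > ennreal \<epsilon>})) \<and>
       (\<forall>\<epsilon>>0. vanishing_prob M (\<lambda>n. {\<omega>\<in>space M.
          \<exists>t\<in>{0..T}. norm (simple_integral W (D n) t \<omega> - Y t \<omega>) > \<epsilon>})))"

definition strong_solution ::
  "'w measure \<Rightarrow> real \<Rightarrow> (real \<Rightarrow> 'w measure) \<Rightarrow> (real \<Rightarrow> 'w \<Rightarrow> real^'d) \<Rightarrow>
   (real^'n \<Rightarrow> 'e \<Rightarrow> real^'n) \<Rightarrow> (real^'n \<Rightarrow> 'e \<Rightarrow> real^'d^'n) \<Rightarrow> real^'n \<Rightarrow>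
   (real \<Rightarrow> 'w \<Rightarrow> 'e) \<Rightarrow> (real \<Rightarrow> 'w \<Rightarrow> real^'n) \<Rightarrow> bool" where
  "strong_solution M T F W \<mu> \<sigma> x0 A X \<longleftrightarrow>
     (\<forall>t\<in>{0..T}. X t \<in> borel_measurable (F t)) \<and>
     (AE \<omega> in M. continuous_on {0..T} (\<lambda>t. X t \<omega>)) \<and>
     (AE \<omega> in M. set_integrable lborel {0..T} (\<lambda>s. \<mu> (X s \<omega>) (A s \<omega>))) \<and>
     (\<exists>Y. ito_integral M T F W (\<lambda>s \<omega>. \<sigma> (X s \<omega>) (A s \<omega>)) Y \<and>
       (AE \<omega> in M. \<forall>t\<in>{0..T}.
          X t \<omega> = x0 + (LINT s:{0..t}|lborel. \<mu> (X s \<omega>) (A s \<omega>)) + Y t \<omega>))"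

definition gradient :: "('b::real_inner \<Rightarrow> real) \<Rightarrow> 'b \<Rightarrow> 'b" where
  "gradient h y = (THE v. GDERIV h y :> v)"

definition value_function ::
  "'w measure \<Rightarrow> real \<Rightarrow> (real \<Rightarrow> 'w \<Rightarrow> 'e) set \<Rightarrow> ((real \<Rightarrow> 'w \<Rightarrow> 'e) \<Rightarrow> real \<Rightarrow> 'w \<Rightarrow> real^'n) \<Rightarrow>
   (real \<times> (real^'m) \<Rightarrow> real) \<Rightarrow> (real^'n \<Rightarrow> real) \<Rightarrow> real^'m \<Rightarrow> real" where
  "value_function M T \<A> X f g y = (INF A\<in>\<A>. (LINT \<omega>|M. f (g (X A T \<omega>), y)))"

end

theory Submission
  imports Defs
begin

text \<open>
  Joint convexity makes \<open>V\<close> midpoint convex at \<open>y\<close>, and testing \<open>V (y + \<xi>)\<close> with the control that is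
  optimal at \<open>y\<close> transfers semiconcavity from \<open>f\<close> to \<open>V\<close>. A midpoint convex function lying below a
  paraboloid that touches it at \<open>y\<close> also lies above the reflected paraboloid, hence is differentiable
  there. The analytic input is a bound on \<open>\<E>[\<parallel>X\<^sup>A\<^sub>T\<parallel>\<^sup>2]\<close> uniform in \<open>A\<close>, which makes all
  expectations finite and the infimum a genuine one.
\<close>

subsection \<open>Differentiability by one-sided bounds\<close>

text \<open>The obstacle is the moment bound. \<open>ito_integral\<close> records limits in
  probability only, so no moment of \<open>Y\<close> is known in advance, and a Gronwall argument
  applied directly to the second moment of \<open>X t\<close> would presuppose that it is finite.
  Hence everything is truncated by the accumulated energy of the integrand: elementary integrals are
  switched off before their energy passes a level \<open>R\<close>, their second moments are bounded
  by the expected truncated energy, and Fatou's lemma carries this to the Ito integral. The level is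
  removed only after a Gronwall estimate whose result is free of \<open>R\<close>. Second moments
  suffice since \<open>f\<close> grows quadratically and \<open>g\<close> linearly. Two encodings
  matter. \<open>value_function\<close> is a real infimum, which behaves as a greatest lower bound
  only once boundedness below is shown. \<open>gradient\<close> is a definite description; convexity
  and semiconcavity of \<open>f\<close> together pin its value down as the derivative. Midpoint
  convexity uses arbitrary controls at \<open>y + \<xi>\<close> and \<open>y - \<xi>\<close>,
  because a minimiser is given at \<open>y\<close> alone.\<close>

context
  fixes h :: "'b::real_inner \<Rightarrow> real" and y G :: 'b and m :: real
  assumes mid: "\<And>\<xi>. h y \<le> (h (y + \<xi>) + h (y - \<xi>)) / 2"
    and up: "\<And>\<xi>. h (y + \<xi>) \<le> h y + \<xi> \<bullet> G + 1/2 * m * (norm \<xi>)\<^sup>2"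
begin

text \<open>Midpoint convexity turns the upper bound at \<open>- \<xi>\<close> into a lower bound at
  \<open>\<xi>\<close> with the same linear term. Besides \<open>V\<close>, it serves every section
  of \<open>f\<close>, where it controls difference quotients.\<close>

lemma midpoint_convex_semiconcave_bound:
  "\<bar>h (y + \<xi>) - h y - \<xi> \<bullet> G\<bar> \<le> 1/2 * m * (norm \<xi>)\<^sup>2"
  using mid[of \<xi>] up[of \<xi>] up[of "- \<xi>"]
  unfolding abs_le_iff by (auto simp: field_simps)

lemma midpoint_convex_semiconcave_GDERIV: "GDERIV h y :> G"
proof -
  have "((\<lambda>\<xi>. 1/2 * m * norm \<xi>) \<longlongrightarrow> 0) (at (0::'b))"
    by (auto intro!: tendsto_eq_intros)
  then have "((\<lambda>\<xi>. norm (h (y + \<xi>) - h y - \<xi> \<bullet> G) / norm \<xi>) \<longlongrightarrow> 0) (at 0)"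
  proof (rule Lim_null_comparison[rotated])
    show "\<forall>\<^sub>F \<xi> in at 0. norm (norm (h (y + \<xi>) - h y - \<xi> \<bullet> G) / norm \<xi>) \<le> 1/2 * m * norm \<xi>"
    proof (rule eventually_at_filter[THEN iffD2], rule always_eventually, intro allI impI)
      fix \<xi> :: 'b assume "\<xi> \<noteq> 0"
      then show "norm (norm (h (y + \<xi>) - h y - \<xi> \<bullet> G) / norm \<xi>) \<le> 1/2 * m * norm \<xi>"
        using midpoint_convex_semiconcave_bound[of \<xi>]
        by (simp add: divide_le_eq power2_eq_square mult.assoc)
    qed
  qed
  then show ?thesis
    by (simp add: gderiv_def has_derivative_at bounded_linear_inner_left)
qed

end

subsection \<open>Increments of Brownian motion\<close>

lemma norm_vec_squared: "(norm (x :: 'b::real_normed_vector^'n))\<^sup>2 = (\<Sum>a\<in>UNIV. (norm (x $ a))\<^sup>2)"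
  by (simp add: norm_vec_def L2_set_def sum_nonneg)

text \<open>The norm of \<open>real^'d^'n\<close> is the Frobenius norm, so Cauchy-Schwarz on each
  row suffices.\<close>

lemma norm_matrix_vector_mult_le_Frobenius:
  fixes A :: "real^'d^'n"
  shows "norm (A *v x) \<le> norm A * norm x"
proof (rule power2_le_imp_le)
  have "(norm (A *v x))\<^sup>2 \<le> (\<Sum>a\<in>UNIV. (norm (A $ a))\<^sup>2 * (norm x)\<^sup>2)"
    unfolding norm_vec_squared[of "A *v x"] matrix_vector_mul_component real_norm_def power_mult_distrib[symmetric]
    by (intro sum_mono power2_mono) (use Cauchy_Schwarz_ineq2 in auto)
  also have "\<dots> = (norm A * norm x)\<^sup>2"
    by (simp add: norm_vec_squared[of A] power_mult_distrib sum_distrib_right)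
  finally show "(norm (A *v x))\<^sup>2 \<le> (norm A * norm x)\<^sup>2" .
qed simp

lemma borel_measurable_vec_nth [measurable (raw)]:
  fixes f :: "'a \<Rightarrow> 'b::real_normed_vector^'n"
  assumes "f \<in> borel_measurable M"
  shows "(\<lambda>x. f x $ i) \<in> borel_measurable M"
  by (rule borel_measurable_continuous_on[OF _ assms]) (intro continuous_intros)

lemma borel_measurable_matrix_vector_mult [measurable (raw)]:
  fixes f :: "'a \<Rightarrow> real^'d^'n"
  assumes [measurable]: "f \<in> borel_measurable M" "g \<in> borel_measurable M"
  shows "(\<lambda>x. f x *v g x) \<in> borel_measurable M"
proof -
  have "(\<lambda>x. (f x *v g x) $ i) \<in> borel_measurable M" for i
    unfolding matrix_vector_mul_component by measurable
  then show ?thesis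
    by (subst borel_measurable_euclidean_space) (auto simp: Basis_vec_def inner_axis)
qed

locale brownian_setting = prob_space M for M :: "'w measure" +
  fixes T :: real and F :: "real \<Rightarrow> 'w measure" and W :: "real \<Rightarrow> 'w \<Rightarrow> real^'d"
  assumes T_pos: "0 < T"
    and filtration: "usual_filtration M T F"
    and brownian: "brownian_motion M T F W"
begin

lemma space_F: "t \<in> {0..T} \<Longrightarrow> space (F t) = space M"
  and sets_F_subset: "t \<in> {0..T} \<Longrightarrow> sets (F t) \<subseteq> sets M"
  and sets_F_mono: "0 \<le> s \<Longrightarrow> s \<le> t \<Longrightarrow> t \<le> T \<Longrightarrow> sets (F s) \<subseteq> sets (F t)"
  using filtration unfolding usual_filtration_def by auto

lemma measurable_F_imp_M:
  assumes "f \<in> measurable (F t) N" "t \<in> {0..T}"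
  shows "f \<in> measurable M N"
  using assms space_F[of t] sets_F_subset[of t] unfolding measurable_def by auto

lemma measurable_F_mono:
  assumes "f \<in> measurable (F s) N" "0 \<le> s" "s \<le> t" "t \<le> T"
  shows "f \<in> measurable (F t) N"
  using assms space_F[of t] space_F[of s] sets_F_mono[of s t] unfolding measurable_def by auto

lemma W_measurable_F: "s \<in> {0..t} \<Longrightarrow> t \<le> T \<Longrightarrow> W s \<in> borel_measurable (F t)"
  using brownian unfolding brownian_motion_def by (auto intro: measurable_F_mono)

lemma W_measurable: "t \<in> {0..T} \<Longrightarrow> W t \<in> borel_measurable M"
  by (rule measurable_F_imp_M[OF W_measurable_F]) auto

context
  fixes s t :: real
  assumes st: "0 \<le> s" "s < t" "t \<le> T"
begin

lemma increment_measurable: "(\<lambda>\<omega>. W t \<omega> - W s \<omega>) \<in> borel_measurable M"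
  using st by (intro borel_measurable_diff W_measurable) auto

lemma increment_distributed:
  "distributed M lborel (\<lambda>\<omega>. (W t \<omega> - W s \<omega>) $ i) (\<lambda>x. ennreal (normal_density 0 (sqrt (t - s)) x))"
  using brownian st unfolding brownian_motion_def by blast

lemma increment_integrable: "integrable M (\<lambda>\<omega>. (W t \<omega> - W s \<omega>) $ i)"
  using st integrable_normal_moment[of "sqrt (t - s)" 0 1]
  by (subst distributed_integrable[OF increment_distributed, symmetric, of "\<lambda>x. x"]) auto

lemma increment_expectation: "expectation (\<lambda>\<omega>. (W t \<omega> - W s \<omega>) $ i) = 0"
  using st by (intro normal_distributed_expectation[OF _ increment_distributed]) auto

lemma increment_norm_integrable: "integrable M (\<lambda>\<omega>. (norm (W t \<omega> - W s \<omega>))\<^sup>2)"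
  and increment_norm_expectation:
    "expectation (\<lambda>\<omega>. (norm (W t \<omega> - W s \<omega>))\<^sup>2) = CARD('d) * (t - s)"
proof -
  have int: "integrable M (\<lambda>\<omega>. ((W t \<omega> - W s \<omega>) $ i)\<^sup>2)" for i
    using st integrable_normal_moment[of "sqrt (t - s)" 0 2]
    by (subst distributed_integrable[OF increment_distributed, symmetric, of "\<lambda>x. x^2"]) auto
  have E: "expectation (\<lambda>\<omega>. ((W t \<omega> - W s \<omega>) $ i)\<^sup>2) = t - s" for i
    using st normal_distributed_variance[OF _ increment_distributed, of i] increment_expectation[of i]
    by simp
  show "integrable M (\<lambda>\<omega>. (norm (W t \<omega> - W s \<omega>))\<^sup>2)"
    unfolding norm_vec_squared real_norm_def power2_abs using int by (rule Bochner_Integration.integrable_sum)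
  show "expectation (\<lambda>\<omega>. (norm (W t \<omega> - W s \<omega>))\<^sup>2) = CARD('d) * (t - s)"
    unfolding norm_vec_squared real_norm_def power2_abs
    by (subst Bochner_Integration.integral_sum[OF int]) (simp only: E, simp)
qed

text \<open>\<open>F s\<close> is independent of the sigma-algebra of the vector increment, and both
  variables generate sub-sigma-algebras of these. The general \<open>\<phi>\<close> covers the two
  uses: one component of the increment and its squared norm.\<close>

lemma increment_indep:
  fixes \<zeta> :: "'w \<Rightarrow> real" and \<phi> :: "real^'d \<Rightarrow> real"
  assumes \<zeta>: "\<zeta> \<in> borel_measurable (F s)" and \<phi>[measurable]: "\<phi> \<in> borel_measurable borel"
  shows "indep_var borel \<zeta> borel (\<lambda>\<omega>. \<phi> (W t \<omega> - W s \<omega>))"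
proof (subst indep_var_eq, intro conjI)
  note [measurable] = increment_measurable
  show "random_variable borel \<zeta>" using st by (intro measurable_F_imp_M[OF \<zeta>]) auto
  show "random_variable borel (\<lambda>\<omega>. \<phi> (W t \<omega> - W s \<omega>))" by measurable
  let ?V = "vimage_algebra (space M) (\<lambda>\<omega>. W t \<omega> - W s \<omega>) borel"
  have "indep_set (sets (F s)) (sets ?V)"
    using brownian st unfolding brownian_motion_def by blast
  moreover have sub: "sigma_sets (space M) {f -` A \<inter> space M |A. A \<in> sets borel} \<subseteq> sets N"
    if "f \<in> borel_measurable N" "space N = space M" for f :: "'w \<Rightarrow> real" and N
    using measurable_sets[OF that(1)] sets.top[of N] unfolding that(2)
    by (intro sets.sigma_sets_subset') blast+
  moreover have "(\<lambda>\<omega>. \<phi> (W t \<omega> - W s \<omega>)) \<in> borel_measurable ?V"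
    by (rule measurable_compose[OF measurable_vimage_algebra1 \<phi>]) auto
  ultimately have "sigma_sets (space M) {\<zeta> -` A \<inter> space M |A. A \<in> sets borel} \<subseteq> sets (F s)"
    "sigma_sets (space M) {(\<lambda>\<omega>. \<phi> (W t \<omega> - W s \<omega>)) -` A \<inter> space M |A. A \<in> sets borel} \<subseteq> sets ?V"
    using sub[OF \<zeta>] space_F[of s] st by auto
  with \<open>indep_set (sets (F s)) (sets ?V)\<close>
  show "indep_set (sigma_sets (space M) {\<zeta> -` A \<inter> space M |A. A \<in> sets borel})
     (sigma_sets (space M) {(\<lambda>\<omega>. \<phi> (W t \<omega> - W s \<omega>)) -` A \<inter> space M |A. A \<in> sets borel})"
    unfolding indep_set_def
    by (rule_tac indep_sets_mono_sets) (assumption, simp split: bool.split)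
qed

text \<open>
  Cross terms vanish because \<open>S\<close> and \<open>\<eta>\<close> are known at time \<open>s\<close>; the factor \<open>CARD('d)\<close> is the price for
  bounding \<open>\<parallel>\<eta> \<Delta>W\<parallel>\<close> by \<open>\<parallel>\<eta>\<parallel> \<parallel>\<Delta>W\<parallel>\<close>, which makes independence of the components of \<open>W\<close> irrelevant.
\<close>

lemma increment_step:
  fixes \<eta> :: "'w \<Rightarrow> real^'d^'n"
  assumes \<eta>: "\<eta> \<in> borel_measurable (F s)" and B: "\<And>\<omega>. \<omega> \<in> space M \<Longrightarrow> norm (\<eta> \<omega>) \<le> B"
    and S: "S \<in> borel_measurable (F s)" and S2: "integrable M (\<lambda>\<omega>. (norm (S \<omega>))\<^sup>2)"
  defines "R \<equiv> \<lambda>\<omega>. S \<omega> + \<eta> \<omega> *v (W t \<omega> - W s \<omega>)"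
  shows "integrable M (\<lambda>\<omega>. (norm (R \<omega>))\<^sup>2)"
    and "expectation (\<lambda>\<omega>. (norm (R \<omega>))\<^sup>2) \<le>
      expectation (\<lambda>\<omega>. (norm (S \<omega>))\<^sup>2) + CARD('d) * (expectation (\<lambda>\<omega>. (norm (\<eta> \<omega>))\<^sup>2) * (t - s))"
proof -
  define U where "U \<omega> = W t \<omega> - W s \<omega>" for \<omega>
  have U[measurable]: "U \<in> borel_measurable M"
    unfolding U_def by (rule increment_measurable)
  have \<eta>M[measurable]: "\<eta> \<in> borel_measurable M" and SM[measurable]: "S \<in> borel_measurable M"
    using st by (auto intro!: measurable_F_imp_M[OF \<eta>] measurable_F_imp_M[OF S])
  \<comment> \<open>The \<open>b\<close>-th component of the transpose of \<open>\<eta>\<close>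
    applied to \<open>S\<close>. The cross term becomes a sum of products of a variable known at
    time \<open>s\<close> with a centred component of \<open>U\<close>.\<close>
  define \<zeta> where "\<zeta> b \<omega> = (\<Sum>a\<in>UNIV. \<eta> \<omega> $ a $ b * S \<omega> $ a)" for b \<omega>
  have S1: "integrable M (\<lambda>\<omega>. norm (S \<omega>))"
    by (rule square_integrable_imp_integrable[OF _ S2]) measurable
  have "\<zeta> b \<in> borel_measurable (F s)" for b
    unfolding \<zeta>_def using \<eta> S by measurable
  moreover have "integrable M (\<zeta> b)" for b
    unfolding \<zeta>_def
  proof (rule Bochner_Integration.integrable_sum, rule Bochner_Integration.integrable_bound)
    show "integrable M (\<lambda>\<omega>. B * norm (S \<omega>))" using S1 by simp
    show "AE \<omega> in M. norm (\<eta> \<omega> $ a $ b * S \<omega> $ a) \<le> norm (B * norm (S \<omega>))" for a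
    proof (rule AE_I2)
      fix \<omega> assume "\<omega> \<in> space M"
      have "\<bar>\<eta> \<omega> $ a $ b\<bar> \<le> B"
        using B[OF \<open>\<omega> \<in> space M\<close>] Finite_Cartesian_Product.norm_nth_le[of "\<eta> \<omega>" a]
          Finite_Cartesian_Product.norm_nth_le[of "\<eta> \<omega> $ a" b] by simp
      then have "\<bar>\<eta> \<omega> $ a $ b\<bar> * \<bar>S \<omega> $ a\<bar> \<le> B * norm (S \<omega>)"
        using Finite_Cartesian_Product.norm_nth_le[of "S \<omega>" a] by (intro mult_mono) auto
      then show "norm (\<eta> \<omega> $ a $ b * S \<omega> $ a) \<le> norm (B * norm (S \<omega>))"
        unfolding real_norm_def abs_mult[of "\<eta> \<omega> $ a $ b"] by linarith
    qed
  qed measurable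
  moreover have "indep_var borel (\<zeta> b) borel (\<lambda>\<omega>. U \<omega> $ b)" for b
    unfolding U_def by (rule increment_indep[of _ "\<lambda>u. u $ b"]) (use calculation in measurable)
  ultimately have cross: "integrable M (\<lambda>\<omega>. \<zeta> b \<omega> * U \<omega> $ b)" "expectation (\<lambda>\<omega>. \<zeta> b \<omega> * U \<omega> $ b) = 0" for b
    using indep_var_integrable[of "\<zeta> b"] indep_var_lebesgue_integral[of "\<zeta> b"]
      increment_integrable[of b, folded U_def] increment_expectation[of b, folded U_def]
    by force+
  have \<eta>2: "integrable M (\<lambda>\<omega>. (norm (\<eta> \<omega>))\<^sup>2)"
    by (rule integrable_const_bound[where B = "B^2"]) (auto intro!: AE_I2 power_mono B)
  have diag: "integrable M (\<lambda>\<omega>. (norm (\<eta> \<omega>))\<^sup>2 * (norm (U \<omega>))\<^sup>2)"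
    "expectation (\<lambda>\<omega>. (norm (\<eta> \<omega>))\<^sup>2 * (norm (U \<omega>))\<^sup>2) = expectation (\<lambda>\<omega>. (norm (\<eta> \<omega>))\<^sup>2) * (CARD('d) * (t - s))"
  proof -
    note U2 = increment_norm_integrable[folded U_def] increment_norm_expectation[folded U_def]
    have indep: "indep_var borel (\<lambda>\<omega>. (norm (\<eta> \<omega>))\<^sup>2) borel (\<lambda>\<omega>. (norm (U \<omega>))\<^sup>2)"
      unfolding U_def by (rule increment_indep[of _ "\<lambda>u. (norm u)\<^sup>2"]) (use \<eta> in measurable)
    show "integrable M (\<lambda>\<omega>. (norm (\<eta> \<omega>))\<^sup>2 * (norm (U \<omega>))\<^sup>2)"
      by (rule indep_var_integrable[OF indep \<eta>2 U2(1)])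
    show "expectation (\<lambda>\<omega>. (norm (\<eta> \<omega>))\<^sup>2 * (norm (U \<omega>))\<^sup>2) = expectation (\<lambda>\<omega>. (norm (\<eta> \<omega>))\<^sup>2) * (CARD('d) * (t - s))"
      unfolding indep_var_lebesgue_integral[OF indep \<eta>2 U2(1)] U2(2) ..
  qed
  have le: "(norm (R \<omega>))\<^sup>2 \<le> (norm (S \<omega>))\<^sup>2 + 2 * (\<Sum>b\<in>UNIV. \<zeta> b \<omega> * U \<omega> $ b) + (norm (\<eta> \<omega>))\<^sup>2 * (norm (U \<omega>))\<^sup>2" for \<omega>
  proof -
    have "S \<omega> \<bullet> (\<eta> \<omega> *v U \<omega>) = (\<Sum>a\<in>UNIV. \<Sum>b\<in>UNIV. \<eta> \<omega> $ a $ b * S \<omega> $ a * U \<omega> $ b)"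
      by (simp add: inner_vec_def matrix_vector_mult_def sum_distrib_left mult_ac)
    also have "\<dots> = (\<Sum>b\<in>UNIV. \<zeta> b \<omega> * U \<omega> $ b)"
      unfolding \<zeta>_def sum_distrib_right by (rule sum.swap)
    finally have "S \<omega> \<bullet> (\<eta> \<omega> *v U \<omega>) = (\<Sum>b\<in>UNIV. \<zeta> b \<omega> * U \<omega> $ b)" .
    moreover have "(norm (\<eta> \<omega> *v U \<omega>))\<^sup>2 \<le> (norm (\<eta> \<omega>))\<^sup>2 * (norm (U \<omega>))\<^sup>2"
      unfolding power_mult_distrib[symmetric] by (intro power_mono norm_matrix_vector_mult_le_Frobenius) auto
    ultimately show ?thesis
      using dot_norm[of "S \<omega>" "\<eta> \<omega> *v U \<omega>"] unfolding R_def U_def[symmetric] by simp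
  qed
  let ?D = "\<lambda>\<omega>. (norm (S \<omega>))\<^sup>2 + 2 * (\<Sum>b\<in>UNIV. \<zeta> b \<omega> * U \<omega> $ b) + (norm (\<eta> \<omega>))\<^sup>2 * (norm (U \<omega>))\<^sup>2"
  have D: "integrable M ?D" using S2 cross(1) diag(1) by auto
  show R: "integrable M (\<lambda>\<omega>. (norm (R \<omega>))\<^sup>2)"
    by (rule Bochner_Integration.integrable_bound[OF D])
      (auto simp: R_def U_def[symmetric] intro!: AE_I2 order.trans[OF le[unfolded R_def U_def[symmetric]]])
  have "expectation (\<lambda>\<omega>. (norm (R \<omega>))\<^sup>2) \<le> expectation ?D"
    by (rule integral_mono[OF R D]) (rule le)
  also have "\<dots> = expectation (\<lambda>\<omega>. (norm (S \<omega>))\<^sup>2) + CARD('d) * (expectation (\<lambda>\<omega>. (norm (\<eta> \<omega>))\<^sup>2) * (t - s))"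
    using S2 cross diag by simp
  finally show "expectation (\<lambda>\<omega>. (norm (R \<omega>))\<^sup>2) \<le>
      expectation (\<lambda>\<omega>. (norm (S \<omega>))\<^sup>2) + CARD('d) * (expectation (\<lambda>\<omega>. (norm (\<eta> \<omega>))\<^sup>2) * (t - s))" .
qed

end

end

subsection \<open>Elementary stochastic integrals stopped at an energy level\<close>

text \<open>For ordered nonnegative partition points and \<open>0 \<le> t\<close> this is the
  squared norm of the simple process integrated over \<open>[0,t]\<close>; clipping with
  \<open>min t\<close> discards what lies beyond \<open>t\<close>.\<close>

definition energy :: "(nat \<Rightarrow> real) \<Rightarrow> real \<Rightarrow> (nat \<Rightarrow> 'w \<Rightarrow> 'b::real_normed_vector) \<Rightarrow> nat \<Rightarrow> 'w \<Rightarrow> real" where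
  "energy p t \<xi> k \<omega> = (\<Sum>i<k. (norm (\<xi> i \<omega>))\<^sup>2 * (min t (p (Suc i)) - min t (p i)))"

text \<open>
  The coefficient on \<open>(p i, p (i+1)]\<close> is switched off as soon as the energy up to the right end point
  exceeds \<open>R\<close>; this is known at time \<open>p i\<close>, and the energy never overshoots \<open>R\<close>.
\<close>

definition stopped :: "real \<Rightarrow> (nat \<Rightarrow> real) \<Rightarrow> real \<Rightarrow> (nat \<Rightarrow> 'w \<Rightarrow> 'b::real_normed_vector) \<Rightarrow> nat \<Rightarrow> 'w \<Rightarrow> 'b" where
  "stopped R p t \<xi> i \<omega> = (if energy p t \<xi> (Suc i) \<omega> \<le> R then \<xi> i \<omega> else 0)"

lemma Suc_mono_up_to:
  fixes p :: "nat \<Rightarrow> real"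
  assumes "\<And>i. i < k \<Longrightarrow> p i \<le> p (Suc i)" "j \<le> k"
  shows "p j \<le> p k"
  using assms(2) by (induction rule: inc_induct) (use assms(1) order.trans in blast)+

lemma min_diff_nonneg: "a \<le> b \<Longrightarrow> 0 \<le> min t b - min t (a :: real)"
  by (auto simp: min_def)

lemma energy_measurable:
  assumes "\<And>i. i < k \<Longrightarrow> \<xi> i \<in> borel_measurable N"
  shows "energy p t \<xi> k \<in> borel_measurable N"
proof -
  have "(\<lambda>\<omega>. (norm (\<xi> i \<omega>))\<^sup>2 * (min t (p (Suc i)) - min t (p i))) \<in> borel_measurable N" if "i < k" for i
    using assms[OF that] by measurable
  then show ?thesis unfolding energy_def[abs_def] by (intro borel_measurable_sum) auto
qed

lemma energy_Suc: "energy p t \<xi> (Suc k) \<omega> = energy p t \<xi> k \<omega> + (norm (\<xi> k \<omega>))\<^sup>2 * (min t (p (Suc k)) - min t (p k))"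
  by (simp add: energy_def)

lemma energy_mono:
  assumes "\<And>i. i < k \<Longrightarrow> p i \<le> p (Suc i)" "j \<le> k"
  shows "energy p t \<xi> j \<omega> \<le> energy p t \<xi> k \<omega>"
  unfolding energy_def
  by (rule sum_mono2) (use assms in \<open>auto intro!: mult_nonneg_nonneg min_diff_nonneg simp del: diff_ge_0_iff_ge\<close>)

lemma energy_nonneg:
  assumes "\<And>i. i < k \<Longrightarrow> p i \<le> p (Suc i)"
  shows "0 \<le> energy p t \<xi> k \<omega>"
  using energy_mono[of k p 0 t \<xi> \<omega>, OF assms] by (simp add: energy_def)

text \<open>Partial energies grow with the number of steps, so if the total stays within
  \<open>R\<close> no coefficient is ever switched off.\<close>

lemma stopped_eq:
  assumes "\<And>i. i < k \<Longrightarrow> p i \<le> p (Suc i)" "energy p t \<xi> k \<omega> \<le> R" "i < k"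
  shows "stopped R p t \<xi> i \<omega> = \<xi> i \<omega>"
  using energy_mono[of k p "Suc i" t \<xi> \<omega>, OF assms(1)] assms(2,3) by (simp add: stopped_def)

text \<open>Either the energy including the last step is within \<open>R\<close> and stopping has
  changed nothing, or the last coefficient is 0 and the bound for \<open>k\<close> steps already
  gives \<open>R\<close>, which is then the minimum.\<close>

lemma energy_stopped_le:
  assumes "\<And>i. i < k \<Longrightarrow> p i \<le> p (Suc i)" "0 \<le> R"
  shows "energy p t (stopped R p t \<xi>) k \<omega> \<le> min R (energy p t \<xi> k \<omega>)"
  using assms(1)
proof (induction k)
  case 0
  then show ?case using assms(2) by (simp add: energy_def)
next
  case (Suc k)
  show ?case
  proof (cases "energy p t \<xi> (Suc k) \<omega> \<le> R")
    case True
    then have "energy p t (stopped R p t \<xi>) (Suc k) \<omega> = energy p t \<xi> (Suc k) \<omega>"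
      using stopped_eq[of "Suc k" p t \<xi> \<omega> R] Suc.prems unfolding energy_def by (intro sum.cong) auto
    with True show ?thesis by simp
  next
    case False
    then have "energy p t (stopped R p t \<xi>) (Suc k) \<omega> = energy p t (stopped R p t \<xi>) k \<omega>"
      by (simp add: energy_Suc[of _ _ "stopped R p t \<xi>"] stopped_def[of _ _ _ _ k])
    then show ?thesis
      using Suc.IH Suc.prems False by auto
  qed
qed

text \<open>The intervals \<open>(p i, p (i+1)]\<close> are disjoint, so at most one summand
  survives at each time.\<close>

lemma norm_simple_process_squared:
  assumes "\<And>i. i < k \<Longrightarrow> p i \<le> p (Suc i)"
  shows "(norm (simple_process (k, p, \<xi>) s \<omega>))\<^sup>2 = (\<Sum>i<k. indicat_real {p i<..p (Suc i)} s * (norm (\<xi> i \<omega>))\<^sup>2)"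
  using assms
proof (induction k)
  case 0
  then show ?case by (simp add: simple_process_def)
next
  case (Suc k)
  have mono: "p j \<le> p k" if "j \<le> k" for j
    by (rule Suc_mono_up_to) (use that Suc.prems in auto)
  have step: "simple_process (Suc k, p, \<xi>) s \<omega> = simple_process (k, p, \<xi>) s \<omega> + indicat_real {p k<..p (Suc k)} s *\<^sub>R \<xi> k \<omega>"
    unfolding simple_process_def prod.case by (rule sum.lessThan_Suc)
  show ?case
  proof (cases "s \<in> {p k<..p (Suc k)}")
    case True
    have "simple_process (k, p, \<xi>) s \<omega> = 0"
      unfolding simple_process_def prod.case
    proof (intro sum.neutral ballI)
      fix i assume "i \<in> {..<k}"
      then have "p (Suc i) < s" using True mono[of "Suc i"] by auto
      then show "indicat_real {p i<..p (Suc i)} s *\<^sub>R \<xi> i \<omega> = 0" by simp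
    qed
    moreover from this have "(\<Sum>i<k. indicat_real {p i<..p (Suc i)} s * (norm (\<xi> i \<omega>))\<^sup>2) = 0"
      using Suc by simp
    ultimately show ?thesis
      using True step by simp
  next
    case False
    then show ?thesis
      using Suc step by simp
  qed
qed

text \<open>Intersecting \<open>(p i, p (i+1)]\<close> with \<open>[0,t]\<close> gives the interval
  between the clipped points; since \<open>p i\<close> is nonnegative and excluded, nothing is lost
  at 0.\<close>

lemma nn_integral_simple_process:
  assumes p: "\<And>i. i < k \<Longrightarrow> 0 \<le> p i \<and> p i \<le> p (Suc i)" and t: "0 \<le> t"
  shows "(\<integral>\<^sup>+s\<in>{0..t}. ennreal ((norm (simple_process (k, p, \<xi>) s \<omega>))\<^sup>2) \<partial>lborel) = ennreal (energy p t \<xi> k \<omega>)"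
proof -
  have "(\<integral>\<^sup>+s\<in>{0..t}. ennreal ((norm (simple_process (k, p, \<xi>) s \<omega>))\<^sup>2) \<partial>lborel) =
    (\<integral>\<^sup>+s. (\<Sum>i<k. ennreal ((norm (\<xi> i \<omega>))\<^sup>2) * indicator {min t (p i)<..min t (p (Suc i))} s) \<partial>lborel)"
  proof (rule nn_integral_cong)
    fix s
    have "ennreal ((norm (simple_process (k, p, \<xi>) s \<omega>))\<^sup>2) * indicator {0..t} s =
      ennreal (\<Sum>i<k. (norm (\<xi> i \<omega>))\<^sup>2 * indicat_real {p i<..p (Suc i)} s * indicat_real {0..t} s)"
      using p by (subst norm_simple_process_squared) (auto simp: indicator_def mult.commute)
    also have "\<dots> = (\<Sum>i<k. ennreal ((norm (\<xi> i \<omega>))\<^sup>2 * indicat_real {p i<..p (Suc i)} s * indicat_real {0..t} s))"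
      by (rule sum_ennreal[symmetric]) simp
    also have "\<dots> = (\<Sum>i<k. ennreal ((norm (\<xi> i \<omega>))\<^sup>2) * indicator {min t (p i)<..min t (p (Suc i))} s)"
      by (intro sum.cong refl) (use p in \<open>fastforce simp: indicator_def min_def\<close>)
    finally show "ennreal ((norm (simple_process (k, p, \<xi>) s \<omega>))\<^sup>2) * indicator {0..t} s =
      (\<Sum>i<k. ennreal ((norm (\<xi> i \<omega>))\<^sup>2) * indicator {min t (p i)<..min t (p (Suc i))} s)" .
  qed
  also have "\<dots> = (\<Sum>i<k. ennreal ((norm (\<xi> i \<omega>))\<^sup>2) * emeasure lborel {min t (p i)<..min t (p (Suc i))})"
    by (subst nn_integral_sum) (auto intro!: sum.cong nn_integral_cmult_indicator)
  also have "\<dots> = (\<Sum>i<k. ennreal ((norm (\<xi> i \<omega>))\<^sup>2 * (min t (p (Suc i)) - min t (p i))))"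
  proof (intro sum.cong refl)
    fix i assume "i \<in> {..<k}"
    then have "min t (p i) \<le> min t (p (Suc i))" using p by (intro min.mono) auto
    then show "ennreal ((norm (\<xi> i \<omega>))\<^sup>2) * emeasure lborel {min t (p i)<..min t (p (Suc i))} =
      ennreal ((norm (\<xi> i \<omega>))\<^sup>2 * (min t (p (Suc i)) - min t (p i)))"
      by (simp add: ennreal_mult)
  qed
  also have "\<dots> = ennreal (energy p t \<xi> k \<omega>)"
    unfolding energy_def
    by (rule sum_ennreal) (use p in \<open>auto intro!: mult_nonneg_nonneg min_diff_nonneg simp del: diff_ge_0_iff_ge\<close>)
  finally show ?thesis .
qed

section \<open>Second moments of elementary stochastic integrals\<close>

context brownian_setting
begin

text \<open>The integral over the first \<open>j\<close> intervals is known at time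
  \<open>p j\<close>, so \<open>increment_step\<close> adds the next interval without a cross term.
  Measurability is part of the induction for this reason.\<close>

lemma simple_integral_L2:
  fixes \<eta> :: "nat \<Rightarrow> 'w \<Rightarrow> real^'d^'n"
  assumes "simple_integrand M T F (k, p, \<eta>)" and t: "t \<in> {0..T}"
  shows "j \<le> k \<Longrightarrow> simple_integral W (j, p, \<eta>) t \<in> borel_measurable (F (p j)) \<and>
    integrable M (\<lambda>\<omega>. (norm (simple_integral W (j, p, \<eta>) t \<omega>))\<^sup>2) \<and>
    expectation (\<lambda>\<omega>. (norm (simple_integral W (j, p, \<eta>) t \<omega>))\<^sup>2) \<le>
      CARD('d) * (\<Sum>i<j. expectation (\<lambda>\<omega>. (norm (\<eta> i \<omega>))\<^sup>2) * (min t (p (Suc i)) - min t (p i)))"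
proof (induction j)
  case 0
  have "simple_integral W (0, p, \<eta>) t = (\<lambda>\<omega>. 0)"
    by (simp add: simple_integral_def fun_eq_iff)
  then show ?case by simp
next
  case (Suc j)
  let ?S = "simple_integral W (j, p, \<eta>) t"
  let ?a = "min t (p j)" and ?b = "min t (p (Suc j))"
  let ?e = "\<lambda>i. expectation (\<lambda>\<omega>. (norm (\<eta> i \<omega>))\<^sup>2)"
  have IH: "?S \<in> borel_measurable (F (p j))" "integrable M (\<lambda>\<omega>. (norm (?S \<omega>))\<^sup>2)"
    "expectation (\<lambda>\<omega>. (norm (?S \<omega>))\<^sup>2) \<le>
      CARD('d) * (\<Sum>i<j. ?e i * (min t (p (Suc i)) - min t (p i)))"
    using Suc by auto
  have p: "0 \<le> p j" "p j \<le> p (Suc j)" "p (Suc j) \<le> T" and \<eta>: "\<eta> j \<in> borel_measurable (F (p j))"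
    and "\<exists>B. \<forall>\<omega>\<in>space M. norm (\<eta> j \<omega>) \<le> B"
    using assms(1) Suc.prems unfolding simple_integrand_def by auto
  then obtain B where B: "\<And>\<omega>. \<omega> \<in> space M \<Longrightarrow> norm (\<eta> j \<omega>) \<le> B" by blast
  have step: "simple_integral W (Suc j, p, \<eta>) t = (\<lambda>\<omega>. ?S \<omega> + \<eta> j \<omega> *v (W ?b \<omega> - W ?a \<omega>))"
    by (simp add: simple_integral_def fun_eq_iff)
  have meas: "(\<lambda>\<omega>. ?S \<omega> + \<eta> j \<omega> *v (W ?b \<omega> - W ?a \<omega>)) \<in> borel_measurable (F (p (Suc j)))"
  proof -
    have "?S \<in> borel_measurable (F (p (Suc j)))" "\<eta> j \<in> borel_measurable (F (p (Suc j)))"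
      "W ?b \<in> borel_measurable (F (p (Suc j)))" "W ?a \<in> borel_measurable (F (p (Suc j)))"
      using p t IH(1) \<eta> by (auto intro: measurable_F_mono intro!: W_measurable_F)
    then show ?thesis by measurable
  qed
  show ?case
  proof (cases "?a < ?b")
    case True
    \<comment> \<open>A nondegenerate clipped interval starts at \<open>p j\<close> itself, the time
      at which \<open>\<eta> j\<close> and the partial integral are measurable. In the other case
      the increment vanishes.\<close>
    then have a: "?a = p j" by (auto simp: min_def split: if_splits)
    have st: "0 \<le> p j" "p j < ?b" "?b \<le> T" using p True t a by auto
    show ?thesis
      using meas increment_step[OF st \<eta> B IH(1,2)] IH(3) unfolding step a sum.lessThan_Suc distrib_left[of "real CARD('d)"]
      by linarith
  next
    case False
    then have "?b = ?a" using p by (auto simp: min_def split: if_splits)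
    then show ?thesis
      using meas IH unfolding step by simp
  qed
qed

text \<open>Packages the truncation so that the partition stays hidden later: \<open>J\<close> is
  the integral of the stopped coefficients, \<open>Z\<close> the energy of the original ones. The
  bound keeps \<open>min R (Z \<omega>)\<close> instead of \<open>R\<close>, since the Gronwall
  argument needs the actual size of the energy.\<close>

lemma stopped_simple_integral:
  fixes D :: "('w, real^'d^'n) simple_data"
  assumes D: "simple_integrand M T F D" and t: "t \<in> {0..T}" and "0 \<le> R"
  shows "\<exists>J Z. J \<in> borel_measurable M \<and> Z \<in> borel_measurable M \<and>
    (\<forall>\<omega>. 0 \<le> Z \<omega> \<and>
       (\<integral>\<^sup>+s\<in>{0..t}. ennreal ((norm (simple_process D s \<omega>))\<^sup>2) \<partial>lborel) = ennreal (Z \<omega>) \<and>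
       (Z \<omega> \<le> R \<longrightarrow> J \<omega> = simple_integral W D t \<omega>)) \<and>
    (\<integral>\<^sup>+\<omega>. ennreal ((norm (J \<omega>))\<^sup>2) \<partial>M) \<le> ennreal (CARD('d) * expectation (\<lambda>\<omega>. min R (Z \<omega>)))"
proof -
  obtain k p \<xi> where D_eq: "D = (k, p, \<xi>)" by (cases D)
  have p: "0 \<le> p i" "p i \<le> p (Suc i)" "p (Suc i) \<le> T" and \<xi>: "\<xi> i \<in> borel_measurable (F (p i))"
    and bdd: "\<exists>B. \<forall>\<omega>\<in>space M. norm (\<xi> i \<omega>) \<le> B" if "i < k" for i
    using D that unfolding D_eq simple_integrand_def by auto
  have \<xi>_F: "\<xi> j \<in> borel_measurable (F (p i))" if "j \<le> i" "i < k" for i j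
  proof (rule measurable_F_mono[OF \<xi>])
    show "p j \<le> p i"
      by (rule Suc_mono_up_to) (use that p in auto)
  qed (use that p[of i] p[of j] in auto)
  define \<eta> where "\<eta> = stopped R p t \<xi>"
  have "simple_integrand M T F (k, p, \<eta>)"
  proof -
    have "\<eta> i \<in> borel_measurable (F (p i))" if "i < k" for i
    proof -
      have [measurable]: "energy p t \<xi> (Suc i) \<in> borel_measurable (F (p i))"
        by (rule energy_measurable[OF \<xi>_F]) (use that in auto)
      note [measurable] = \<xi>[OF that]
      show ?thesis unfolding \<eta>_def stopped_def[abs_def] by measurable
    qed
    moreover have "\<exists>B. \<forall>\<omega>\<in>space M. norm (\<eta> i \<omega>) \<le> B" if i: "i < k" for i
    proof -
      obtain B where "\<forall>\<omega>\<in>space M. norm (\<xi> i \<omega>) \<le> B" using bdd[OF i] by blast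
      then have "\<forall>\<omega>\<in>space M. norm (\<eta> i \<omega>) \<le> max B 0" by (auto simp: \<eta>_def stopped_def)
      then show ?thesis by blast
    qed
    ultimately show ?thesis unfolding simple_integrand_def using p by auto
  qed
  from simple_integral_L2[OF this t order.refl]
  have J: "integrable M (\<lambda>\<omega>. (norm (simple_integral W (k, p, \<eta>) t \<omega>))\<^sup>2)"
    "expectation (\<lambda>\<omega>. (norm (simple_integral W (k, p, \<eta>) t \<omega>))\<^sup>2) \<le>
      CARD('d) * (\<Sum>i<k. expectation (\<lambda>\<omega>. (norm (\<eta> i \<omega>))\<^sup>2) * (min t (p (Suc i)) - min t (p i)))"
    by auto
  have \<xi>M: "\<xi> i \<in> borel_measurable M" if "i < k" for i
    by (rule measurable_F_imp_M[OF \<xi>[OF that]]) (use p[OF that] in auto)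
  have \<eta>M: "\<eta> i \<in> borel_measurable M" if "i < k" for i
  proof -
    have [measurable]: "energy p t \<xi> (Suc i) \<in> borel_measurable M"
      by (rule energy_measurable[OF \<xi>M]) (use that in auto)
    show ?thesis
      using \<xi>M[OF that] unfolding \<eta>_def stopped_def[abs_def] by measurable
  qed
  have ZM: "energy p t \<xi> k \<in> borel_measurable M"
    by (rule energy_measurable[OF \<xi>M])
  have JM: "simple_integral W (k, p, \<eta>) t \<in> borel_measurable M"
    unfolding simple_integral_def prod.case
    by (intro borel_measurable_sum borel_measurable_matrix_vector_mult \<eta>M borel_measurable_diff W_measurable)
      (use p t order.trans[OF p(1,2)] in auto)
  have Z0: "0 \<le> energy p t \<xi> k \<omega>" for \<omega> using p by (intro energy_nonneg) auto
  have bound_int: "integrable M (\<lambda>\<omega>. min R (energy p t \<xi> k \<omega>))"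
    by (rule integrable_const_bound[where B = R]) (use ZM Z0 \<open>0 \<le> R\<close> in auto)
  have "(\<Sum>i<k. expectation (\<lambda>\<omega>. (norm (\<eta> i \<omega>))\<^sup>2) * (min t (p (Suc i)) - min t (p i))) =
      expectation (energy p t \<eta> k)"
  proof -
    have "integrable M (\<lambda>\<omega>. (norm (\<eta> i \<omega>))\<^sup>2)" if i: "i < k" for i
    proof -
      obtain B where B: "\<forall>\<omega>\<in>space M. norm (\<xi> i \<omega>) \<le> B" using bdd[OF i] by blast
      have "norm ((norm (\<eta> i \<omega>))\<^sup>2) \<le> (max B 0)\<^sup>2" if "\<omega> \<in> space M" for \<omega>
        unfolding real_norm_def abs_power2
        by (rule power_mono) (use B that in \<open>auto simp: \<eta>_def stopped_def\<close>)
      then show ?thesis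
        using \<eta>M[OF i] by (intro integrable_const_bound[where B = "(max B 0)\<^sup>2"]) (auto intro!: AE_I2)
    qed
    then show ?thesis
      unfolding energy_def[abs_def] by (subst Bochner_Integration.integral_sum) auto
  qed
  also have "\<dots> \<le> expectation (\<lambda>\<omega>. min R (energy p t \<xi> k \<omega>))"
    using energy_stopped_le[of k p R t \<xi>] p \<open>0 \<le> R\<close> Z0
    by (intro integral_mono'[OF bound_int]) (auto simp: \<eta>_def)
  finally have "expectation (\<lambda>\<omega>. (norm (simple_integral W (k, p, \<eta>) t \<omega>))\<^sup>2) \<le>
      CARD('d) * expectation (\<lambda>\<omega>. min R (energy p t \<xi> k \<omega>))"
    using J(2) by (meson mult_left_mono of_nat_0_le_iff order.trans)
  then have "(\<integral>\<^sup>+\<omega>. ennreal ((norm (simple_integral W (k, p, \<eta>) t \<omega>))\<^sup>2) \<partial>M) \<le>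
      ennreal (CARD('d) * expectation (\<lambda>\<omega>. min R (energy p t \<xi> k \<omega>)))"
    using J(1) by (subst nn_integral_eq_integral) (auto intro: ennreal_leI)
  moreover have "simple_integral W (k, p, \<eta>) t \<omega> = simple_integral W D t \<omega>" if "energy p t \<xi> k \<omega> \<le> R" for \<omega>
    using stopped_eq[of k p t \<xi> \<omega> R] p that by (simp add: D_eq simple_integral_def \<eta>_def)
  moreover have "(\<integral>\<^sup>+s\<in>{0..t}. ennreal ((norm (simple_process D s \<omega>))\<^sup>2) \<partial>lborel) = ennreal (energy p t \<xi> k \<omega>)" for \<omega>
    unfolding D_eq by (rule nn_integral_simple_process) (use p t in auto)
  ultimately show ?thesis
    using JM ZM Z0 by (intro exI[of _ "simple_integral W (k, p, \<eta>) t"] exI[of _ "energy p t \<xi> k"]) auto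
qed

end

subsection \<open>Localised bound for the Ito integral\<close>

context prob_space
begin

lemma vanishing_prob_Un:
  assumes "vanishing_prob M E" "vanishing_prob M E'"
  shows "vanishing_prob M (\<lambda>n. E n \<union> E' n)"
proof -
  obtain S S' where S: "\<forall>n. S n \<in> sets M \<and> E n \<subseteq> S n" "(\<lambda>n. measure M (S n)) \<longlonglongrightarrow> 0"
    and S': "\<forall>n. S' n \<in> sets M \<and> E' n \<subseteq> S' n" "(\<lambda>n. measure M (S' n)) \<longlonglongrightarrow> 0"
    using assms unfolding vanishing_prob_def by blast
  have "(\<lambda>n. measure M (S n \<union> S' n)) \<longlonglongrightarrow> 0"
  proof (rule tendsto_sandwich[OF _ _ tendsto_const])
    show "(\<lambda>n. measure M (S n) + measure M (S' n)) \<longlonglongrightarrow> 0"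
      using tendsto_add[OF S(2) S'(2)] by simp
  qed (use S S' in \<open>auto intro!: always_eventually measure_Un_le\<close>)
  then show ?thesis
    unfolding vanishing_prob_def using S S' by (intro exI[of _ "\<lambda>n. S n \<union> S' n"]) blast
qed

text \<open>Borel-Cantelli: \<open>r j\<close> is chosen so that a measurable cover of the bad event
  with tolerance \<open>1 / Suc j\<close> has probability at most \<open>(1/2) ^ j\<close>. The
  tolerance thus shrinks along the same index \<open>j\<close>.\<close>

lemma vanishing_prob_AE_subsequence:
  assumes "\<And>e::real. 0 < e \<Longrightarrow> vanishing_prob M (E e)"
  shows "\<exists>r. AE \<omega> in M. \<forall>\<^sub>F j in sequentially. \<omega> \<notin> E (1 / Suc j) (r j)"
proof -
  have "\<exists>n S. S \<in> sets M \<and> E (1 / Suc j) n \<subseteq> S \<and> measure M S \<le> (1/2) ^ j" for j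
  proof -
    obtain S where S: "\<forall>n. S n \<in> sets M \<and> E (1 / Suc j) n \<subseteq> S n" "(\<lambda>n. measure M (S n)) \<longlonglongrightarrow> 0"
      using assms[of "1 / Suc j"] unfolding vanishing_prob_def by auto
    have "\<forall>\<^sub>F n in sequentially. measure M (S n) < (1/2) ^ j"
      by (rule order_tendstoD(2)[OF S(2)]) simp
    then obtain n where "measure M (S n) < (1/2) ^ j"
      by (auto simp: eventually_sequentially)
    then show ?thesis using S(1) by (meson less_imp_le)
  qed
  then obtain r S where S: "\<And>j. S j \<in> sets M" "\<And>j. E (1 / Suc j) (r j) \<subseteq> S j"
    "\<And>j. measure M (S j) \<le> (1/2) ^ j"
    by metis
  have "AE \<omega> in M. \<forall>\<^sub>F j in sequentially. \<omega> \<in> space M - S j"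
  proof (rule borel_cantelli_AE1)
    show "summable (\<lambda>j. measure M (S j))"
      by (rule summable_comparison_test'[of "\<lambda>j. (1/2::real) ^ j" 0]) (use S(3) in \<open>auto intro: summable_geometric\<close>)
  qed (use S in \<open>auto simp: emeasure_eq_measure\<close>)
  then have "AE \<omega> in M. \<forall>\<^sub>F j in sequentially. \<omega> \<notin> E (1 / Suc j) (r j)"
  proof eventually_elim
    case (elim \<omega>)
    then show ?case by (rule eventually_mono) (use S(2) in blast)
  qed
  then show ?thesis by blast
qed

end

text \<open>Source of the factor 2 in \<open>2 * Q \<omega>\<close> below: energies of approximating
  simple processes are compared with that of \<open>H\<close> through it.\<close>

lemma nn_integral_norm_squared_le:
  fixes u v :: "'a \<Rightarrow> 'b::euclidean_space"
  assumes [measurable]: "u \<in> borel_measurable N" "v \<in> borel_measurable N" "A \<in> sets N"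
  shows "(\<integral>\<^sup>+s\<in>A. ennreal ((norm (u s))\<^sup>2) \<partial>N) \<le>
    2 * (\<integral>\<^sup>+s\<in>A. ennreal ((norm (u s - v s))\<^sup>2) \<partial>N) + 2 * (\<integral>\<^sup>+s\<in>A. ennreal ((norm (v s))\<^sup>2) \<partial>N)"
proof -
  have "ennreal ((norm (u s))\<^sup>2) \<le> 2 * ennreal ((norm (u s - v s))\<^sup>2) + 2 * ennreal ((norm (v s))\<^sup>2)" for s
  proof -
    have "norm (u s) \<le> norm (u s - v s) + norm (v s)"
      by (metis diff_add_cancel norm_triangle_ineq)
    then have "(norm (u s))\<^sup>2 \<le> (norm (u s - v s) + norm (v s))\<^sup>2"
      by (intro power_mono) auto
    also have "\<dots> \<le> 2 * (norm (u s - v s))\<^sup>2 + 2 * (norm (v s))\<^sup>2"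
      using sum_squares_bound[of "norm (u s - v s)" "norm (v s)"] by (simp add: power2_sum)
    finally have "ennreal ((norm (u s))\<^sup>2) \<le> ennreal (2 * (norm (u s - v s))\<^sup>2 + 2 * (norm (v s))\<^sup>2)"
      by (rule ennreal_leI)
    then show ?thesis
      by (simp add: ennreal_plus ennreal_mult)
  qed
  then have "(\<integral>\<^sup>+s\<in>A. ennreal ((norm (u s))\<^sup>2) \<partial>N) \<le>
      (\<integral>\<^sup>+s. 2 * (ennreal ((norm (u s - v s))\<^sup>2) * indicator A s) + 2 * (ennreal ((norm (v s))\<^sup>2) * indicator A s) \<partial>N)"
    by (intro nn_integral_mono) (simp split: split_indicator)
  also have "\<dots> = 2 * (\<integral>\<^sup>+s\<in>A. ennreal ((norm (u s - v s))\<^sup>2) \<partial>N) + 2 * (\<integral>\<^sup>+s\<in>A. ennreal ((norm (v s))\<^sup>2) \<partial>N)"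
    by (subst nn_integral_add) (measurable, simp add: nn_integral_cmult)
  finally show ?thesis .
qed

lemma simple_process_measurable:
  fixes D :: "('w, 'b::euclidean_space) simple_data"
  shows "(\<lambda>s. simple_process D s \<omega>) \<in> borel_measurable borel"
proof (cases D)
  case (fields k p \<xi>)
  have "(\<lambda>s. \<Sum>i<k. indicat_real {p i<..p (Suc i)} s *\<^sub>R \<xi> i \<omega>) \<in> borel_measurable borel"
    by (rule borel_measurable_sum) measurable
  then show ?thesis
    unfolding fields simple_process_def prod.case .
qed

context brownian_setting
begin

lemma prog_measurable_path:
  fixes H :: "real \<Rightarrow> 'w \<Rightarrow> 'b::euclidean_space"
  assumes "prog_measurable T F H" "\<omega> \<in> space M"
  shows "(\<lambda>s. indicat_real {0..T} s *\<^sub>R H s \<omega>) \<in> borel_measurable borel"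
proof -
  have "(\<lambda>(s, \<omega>). H s \<omega>) \<in> borel_measurable (restrict_space borel {0..T} \<Otimes>\<^sub>M F T)"
    using assms(1) T_pos unfolding prog_measurable_def by auto
  moreover have "\<omega> \<in> space (F T)" using assms(2) space_F[of T] T_pos by auto
  ultimately have "(\<lambda>s. (\<lambda>(s, \<omega>). H s \<omega>) (s, \<omega>)) \<in> borel_measurable (restrict_space borel {0..T})"
    by (rule measurable_Pair1)
  then show ?thesis
    by (subst (asm) borel_measurable_restrict_space_iff) auto
qed

text \<open>Where \<open>2 * Q \<omega> < R\<close>, the energies of the approximating simple
  processes eventually lie below \<open>R\<close>, so stopping is inactive and the stopped integrals
  converge to \<open>Y t\<close>. The witness \<open>Z\<close> is the lower limit of their squared
  norms: it is measurable by construction, and Fatou's lemma bounds its integral.\<close>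

lemma ito_integral_localised:
  fixes H :: "real \<Rightarrow> 'w \<Rightarrow> real^'d^'n"
  assumes I: "ito_integral M T F W H Y" and t: "t \<in> {0..T}"
    and Q[measurable]: "Q \<in> borel_measurable M" and Q0: "\<And>\<omega>. 0 \<le> Q \<omega>"
    and HQ: "AE \<omega> in M. (\<integral>\<^sup>+s\<in>{0..t}. ennreal ((norm (H s \<omega>))\<^sup>2) \<partial>lborel) \<le> ennreal (Q \<omega>)"
    and R: "0 \<le> R"
  shows "\<exists>Z\<in>borel_measurable M. (AE \<omega> in M. 2 * Q \<omega> < R \<longrightarrow> ennreal ((norm (Y t \<omega>))\<^sup>2) \<le> Z \<omega>) \<and>
    (\<integral>\<^sup>+\<omega>. Z \<omega> \<partial>M) \<le> ennreal (CARD('d) * expectation (\<lambda>\<omega>. min R (2 * Q \<omega>)))"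
proof -
  define err where "err D \<omega> = (\<integral>\<^sup>+s\<in>{0..T}. ennreal ((norm (simple_process D s \<omega> - H s \<omega>))\<^sup>2) \<partial>lborel)" for D \<omega>
  obtain D where D: "\<And>n. simple_integrand M T F (D n)"
    and D1: "\<And>\<epsilon>::real. \<epsilon> > 0 \<Longrightarrow> vanishing_prob M (\<lambda>n. {\<omega>\<in>space M. err (D n) \<omega> > ennreal \<epsilon>})"
    and D2: "\<And>\<epsilon>::real. \<epsilon> > 0 \<Longrightarrow> vanishing_prob M (\<lambda>n. {\<omega>\<in>space M.
          \<exists>t\<in>{0..T}. norm (simple_integral W (D n) t \<omega> - Y t \<omega>) > \<epsilon>})"
    using I unfolding ito_integral_def err_def by auto
  obtain H' where H': "prog_measurable T F H'" "AE \<omega> in M. \<forall>t\<in>{0..T}. H t \<omega> = H' t \<omega>"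
    using I unfolding ito_integral_def ito_integrand_def by auto
  \<comment> \<open>Both kinds of failure are merged so that one choice of indices serves the
    integrands and the integrals.\<close>
  let ?E = "\<lambda>e n. {\<omega>\<in>space M. err (D n) \<omega> > ennreal e} \<union>
    {\<omega>\<in>space M. \<exists>t\<in>{0..T}. norm (simple_integral W (D n) t \<omega> - Y t \<omega>) > e}"
  have "\<And>e. 0 < e \<Longrightarrow> vanishing_prob M (?E e)"
    by (intro vanishing_prob_Un D1 D2)
  from vanishing_prob_AE_subsequence[of ?E, OF this]
  obtain r where r: "AE \<omega> in M. \<forall>\<^sub>F j in sequentially. \<omega> \<notin> ?E (1 / Suc j) (r j)"
    by blast
  define P where "P j J Z \<longleftrightarrow> J \<in> borel_measurable M \<and> Z \<in> borel_measurable M \<and>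
    (\<forall>\<omega>. 0 \<le> Z \<omega> \<and>
       (\<integral>\<^sup>+s\<in>{0..t}. ennreal ((norm (simple_process (D (r j)) s \<omega>))\<^sup>2) \<partial>lborel) = ennreal (Z \<omega>) \<and>
       (Z \<omega> \<le> R \<longrightarrow> J \<omega> = simple_integral W (D (r j)) t \<omega>)) \<and>
    (\<integral>\<^sup>+\<omega>. ennreal ((norm (J \<omega>))\<^sup>2) \<partial>M) \<le> ennreal (CARD('d) * expectation (\<lambda>\<omega>. min R (Z \<omega>)))" for j J Z
  have "\<exists>J Z. P j J Z" for j
    unfolding P_def by (rule stopped_simple_integral[OF D t R])
  then obtain J Z where P: "\<And>j. P j (J j) (Z j)" by metis
  have J[measurable]: "J j \<in> borel_measurable M" and Z[measurable]: "Z j \<in> borel_measurable M"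
    and Z0: "0 \<le> Z j \<omega>"
    and Z_eq: "(\<integral>\<^sup>+s\<in>{0..t}. ennreal ((norm (simple_process (D (r j)) s \<omega>))\<^sup>2) \<partial>lborel) = ennreal (Z j \<omega>)"
    and J_eq: "Z j \<omega> \<le> R \<Longrightarrow> J j \<omega> = simple_integral W (D (r j)) t \<omega>"
    and J_le: "(\<integral>\<^sup>+\<omega>. ennreal ((norm (J j \<omega>))\<^sup>2) \<partial>M) \<le> ennreal (CARD('d) * expectation (\<lambda>\<omega>. min R (Z j \<omega>)))"
    for j \<omega>
    using P[of j] unfolding P_def by simp_all
  have close: "AE \<omega> in M. \<forall>\<^sub>F j in sequentially.
      Z j \<omega> \<le> 2 * Q \<omega> + 2 / Suc j \<and> norm (simple_integral W (D (r j)) t \<omega> - Y t \<omega>) \<le> 1 / Suc j"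
    using r H'(2) HQ AE_space
  proof eventually_elim
    case (elim \<omega>)
    \<comment> \<open>Only \<open>H'\<close> is progressively measurable; the path of
      \<open>H\<close> inherits measurability for those \<open>\<omega>\<close> at which the two
      agree on \<open>[0,T]\<close>.\<close>
    have HM: "(\<lambda>s. indicat_real {0..T} s *\<^sub>R H s \<omega>) \<in> borel_measurable borel"
    proof -
      have "(\<lambda>s. indicat_real {0..T} s *\<^sub>R H s \<omega>) = (\<lambda>s. indicat_real {0..T} s *\<^sub>R H' s \<omega>)"
        using elim(2) by (intro ext) (simp split: split_indicator)
      then show ?thesis using prog_measurable_path[OF H'(1) elim(4)] by simp
    qed
    from elim(1) show ?case
    proof (rule eventually_mono)
      fix j
      assume "\<omega> \<notin> {\<omega>\<in>space M. err (D (r j)) \<omega> > ennreal (1 / Suc j)} \<union>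
        {\<omega>\<in>space M. \<exists>t\<in>{0..T}. norm (simple_integral W (D (r j)) t \<omega> - Y t \<omega>) > 1 / Suc j}"
      then have err: "err (D (r j)) \<omega> \<le> ennreal (1 / Suc j)"
        and "norm (simple_integral W (D (r j)) t \<omega> - Y t \<omega>) \<le> 1 / Suc j"
        using elim(4) t by (auto simp: not_less)
      let ?S = "\<lambda>s. simple_process (D (r j)) s \<omega>"
      let ?H = "\<lambda>s. indicat_real {0..T} s *\<^sub>R H s \<omega>"
      have "ennreal (Z j \<omega>) = (\<integral>\<^sup>+s\<in>{0..t}. ennreal ((norm (?S s))\<^sup>2) \<partial>lborel)"
        by (rule Z_eq[symmetric])
      also have "\<dots> \<le> 2 * (\<integral>\<^sup>+s\<in>{0..t}. ennreal ((norm (?S s - ?H s))\<^sup>2) \<partial>lborel) +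
          2 * (\<integral>\<^sup>+s\<in>{0..t}. ennreal ((norm (?H s))\<^sup>2) \<partial>lborel)"
        by (rule nn_integral_norm_squared_le) (use HM simple_process_measurable[of "D (r j)" \<omega>] in simp_all)
      also have "\<dots> \<le> 2 * ennreal (1 / Suc j) + 2 * ennreal (Q \<omega>)"
      proof (intro add_mono mult_left_mono)
        have "(\<integral>\<^sup>+s\<in>{0..t}. ennreal ((norm (?S s - ?H s))\<^sup>2) \<partial>lborel) \<le> err (D (r j)) \<omega>"
          unfolding err_def using t by (intro nn_integral_mono) (auto simp: indicator_def)
        then show "(\<integral>\<^sup>+s\<in>{0..t}. ennreal ((norm (?S s - ?H s))\<^sup>2) \<partial>lborel) \<le> ennreal (1 / Suc j)"
          using err by (rule order.trans)
        have "(\<integral>\<^sup>+s\<in>{0..t}. ennreal ((norm (?H s))\<^sup>2) \<partial>lborel) =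
            (\<integral>\<^sup>+s\<in>{0..t}. ennreal ((norm (H s \<omega>))\<^sup>2) \<partial>lborel)"
          using t by (intro nn_integral_cong) (auto simp: indicator_def)
        then show "(\<integral>\<^sup>+s\<in>{0..t}. ennreal ((norm (?H s))\<^sup>2) \<partial>lborel) \<le> ennreal (Q \<omega>)"
          using elim(3) by simp
      qed auto
      also have "2 * ennreal (1 / Suc j) + 2 * ennreal (Q \<omega>) = ennreal (2 * Q \<omega> + 2 / Suc j)"
        using Q0[of \<omega>] by (simp add: ennreal_plus ennreal_mult[symmetric] add.commute flip: ennreal_numeral)
      finally have "ennreal (Z j \<omega>) \<le> ennreal (2 * Q \<omega> + 2 / Suc j)" .
      then have "Z j \<omega> \<le> 2 * Q \<omega> + 2 / Suc j"
        using Q0[of \<omega>] by (subst (asm) ennreal_le_iff) auto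
      then show "Z j \<omega> \<le> 2 * Q \<omega> + 2 / Suc j \<and> norm (simple_integral W (D (r j)) t \<omega> - Y t \<omega>) \<le> 1 / Suc j"
        using \<open>norm _ \<le> _\<close> by simp
    qed
  qed
  have inv0: "(\<lambda>j. c / real (Suc j)) \<longlonglongrightarrow> 0" for c
    by (rule real_tendsto_divide_at_top[OF tendsto_const]) (rule filterlim_compose[OF filterlim_real_sequentially filterlim_Suc])
  \<comment> \<open>The energies \<open>Z j\<close> are only bounded above asymptotically and need
    not converge. The maximum with the limit value does converge, so dominated convergence applies
    with the constant \<open>R\<close>.\<close>
  define m where "m j \<omega> = max (min R (Z j \<omega>)) (min R (2 * Q \<omega>))" for j \<omega>
  have [measurable]: "m j \<in> borel_measurable M" for j
    unfolding m_def by measurable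
  have m_bound: "0 \<le> m j \<omega>" "m j \<omega> \<le> R" for j \<omega>
    using R Q0[of \<omega>] unfolding m_def by auto
  have "(\<lambda>j. expectation (m j)) \<longlonglongrightarrow> expectation (\<lambda>\<omega>. min R (2 * Q \<omega>))"
  proof (rule integral_dominated_convergence[where w = "\<lambda>_. R"])
    show "AE \<omega> in M. (\<lambda>j. m j \<omega>) \<longlonglongrightarrow> min R (2 * Q \<omega>)"
      using close
    proof eventually_elim
      case (elim \<omega>)
      show ?case
      proof (rule tendsto_sandwich[OF _ _ tendsto_const])
        show "(\<lambda>j. min R (2 * Q \<omega>) + 2 / Suc j) \<longlonglongrightarrow> min R (2 * Q \<omega>)"
          using tendsto_add[OF tendsto_const inv0[of 2], of "min R (2 * Q \<omega>)"] by simp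
        show "\<forall>\<^sub>F j in sequentially. m j \<omega> \<le> min R (2 * Q \<omega>) + 2 / Suc j"
          using elim
        proof (rule eventually_mono)
          fix j assume "Z j \<omega> \<le> 2 * Q \<omega> + 2 / Suc j \<and> norm (simple_integral W (D (r j)) t \<omega> - Y t \<omega>) \<le> 1 / Suc j"
          moreover have "0 \<le> 2 / real (Suc j)" by simp
          ultimately show "m j \<omega> \<le> min R (2 * Q \<omega>) + 2 / Suc j"
            unfolding m_def by (smt (verit))
        qed
      qed (simp add: m_def)
    qed
  qed (use m_bound in \<open>auto intro: AE_I2\<close>)
  then have lim: "(\<lambda>j. ennreal (CARD('d) * expectation (m j))) \<longlonglongrightarrow> ennreal (CARD('d) * expectation (\<lambda>\<omega>. min R (2 * Q \<omega>)))"
    by (intro tendsto_ennrealI tendsto_mult tendsto_const)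
  have "(\<integral>\<^sup>+\<omega>. liminf (\<lambda>j. ennreal ((norm (J j \<omega>))\<^sup>2)) \<partial>M) \<le> liminf (\<lambda>j. \<integral>\<^sup>+\<omega>. ennreal ((norm (J j \<omega>))\<^sup>2) \<partial>M)"
    by (rule nn_integral_liminf) measurable
  also have "\<dots> \<le> liminf (\<lambda>j. ennreal (CARD('d) * expectation (m j)))"
  proof (intro Liminf_mono always_eventually allI)
    fix j
    have "expectation (\<lambda>\<omega>. min R (Z j \<omega>)) \<le> expectation (m j)"
      using m_bound[of j] Z0[of j] R
      by (intro integral_mono integrable_const_bound[where B = R]) (auto simp: m_def intro!: AE_I2)
    then show "(\<integral>\<^sup>+\<omega>. ennreal ((norm (J j \<omega>))\<^sup>2) \<partial>M) \<le> ennreal (CARD('d) * expectation (m j))"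
      by (intro order.trans[OF J_le] ennreal_leI mult_left_mono) auto
  qed
  also have "\<dots> = ennreal (CARD('d) * expectation (\<lambda>\<omega>. min R (2 * Q \<omega>)))"
    by (rule lim_imp_Liminf[OF _ lim]) simp
  finally have bound: "(\<integral>\<^sup>+\<omega>. liminf (\<lambda>j. ennreal ((norm (J j \<omega>))\<^sup>2)) \<partial>M) \<le>
    ennreal (CARD('d) * expectation (\<lambda>\<omega>. min R (2 * Q \<omega>)))" .
  have "AE \<omega> in M. 2 * Q \<omega> < R \<longrightarrow> ennreal ((norm (Y t \<omega>))\<^sup>2) \<le> liminf (\<lambda>j. ennreal ((norm (J j \<omega>))\<^sup>2))"
    using close
  proof eventually_elim
    case (elim \<omega>)
    show ?case
    proof
      assume less: "2 * Q \<omega> < R"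
      \<comment> \<open>The strict inequality leaves room for the error \<open>2 / Suc j\<close>;
        hence \<open>Z j \<omega> \<le> R\<close> eventually, and \<open>J j\<close> is the
        unstopped integral.\<close>
      have "\<forall>\<^sub>F j in sequentially. 2 / real (Suc j) < R - 2 * Q \<omega>"
        by (rule order_tendstoD(2)[OF inv0]) (use less in simp)
      with elim have "\<forall>\<^sub>F j in sequentially. norm (J j \<omega> - Y t \<omega>) \<le> 1 / Suc j"
        by eventually_elim (use J_eq in \<open>smt (verit)\<close>)
      then have "(\<lambda>j. J j \<omega> - Y t \<omega>) \<longlonglongrightarrow> 0"
        by (rule Lim_null_comparison[OF _ inv0])
      then have "(\<lambda>j. J j \<omega>) \<longlonglongrightarrow> Y t \<omega>"
        by (rule LIM_zero_cancel)
      then have "(\<lambda>j. ennreal ((norm (J j \<omega>))\<^sup>2)) \<longlonglongrightarrow> ennreal ((norm (Y t \<omega>))\<^sup>2)"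
        by (intro tendsto_ennrealI tendsto_power tendsto_norm)
      then have "liminf (\<lambda>j. ennreal ((norm (J j \<omega>))\<^sup>2)) = ennreal ((norm (Y t \<omega>))\<^sup>2)"
        by (rule lim_imp_Liminf[OF trivial_limit_sequentially])
      then show "ennreal ((norm (Y t \<omega>))\<^sup>2) \<le> liminf (\<lambda>j. ennreal ((norm (J j \<omega>))\<^sup>2))"
        by simp
    qed
  qed
  with bound show ?thesis by (intro bexI[of _ "\<lambda>\<omega>. liminf (\<lambda>j. ennreal ((norm (J j \<omega>))\<^sup>2))"]) auto
qed

end

text \<open>The path is sampled at the grid point \<open>\<lfloor>(n+1) s\<rfloor> / (n+1)\<close>.
  It takes countably many values, so the sampled process is jointly measurable, and continuity gives
  pointwise convergence.\<close>

lemma borel_measurable_continuous_paths: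
  fixes Z :: "real \<Rightarrow> 'w \<Rightarrow> 'b::metric_space"
  assumes meas: "\<And>s. Z s \<in> borel_measurable M"
    and cont: "\<And>\<omega>. \<omega> \<in> space M \<Longrightarrow> continuous_on UNIV (\<lambda>s. Z s \<omega>)"
  shows "(\<lambda>x. Z (fst x) (snd x)) \<in> borel_measurable (borel \<Otimes>\<^sub>M M)"
proof (rule borel_measurable_LIMSEQ_metric)
  let ?d = "\<lambda>n s. real_of_int \<lfloor>real (Suc n) * s\<rfloor> / real (Suc n)"
  show "(\<lambda>x. Z (?d n (fst x)) (snd x)) \<in> borel_measurable (borel \<Otimes>\<^sub>M M)" for n
  proof (rule measurable_compose_countable[where f = "\<lambda>i x. Z (real_of_int i / real (Suc n)) (snd x)"])
    show "(\<lambda>x. Z (real_of_int i / real (Suc n)) (snd x)) \<in> borel_measurable (borel \<Otimes>\<^sub>M M)" for i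
      by (rule measurable_compose[OF measurable_snd meas])
    show "(\<lambda>x. \<lfloor>real (Suc n) * fst x\<rfloor>) \<in> borel \<Otimes>\<^sub>M M \<rightarrow>\<^sub>M count_space UNIV"
      by measurable
  qed
  fix x assume "x \<in> space ((borel :: real measure) \<Otimes>\<^sub>M M)"
  then have "isCont (\<lambda>s. Z s (snd x)) (fst x)"
    using cont[of "snd x"] by (simp add: space_pair_measure mem_Times_iff continuous_on_eq_continuous_at)
  moreover have "(\<lambda>n. ?d n s) \<longlonglongrightarrow> s" for s
  proof (rule LIM_zero_cancel, rule Lim_null_comparison)
    show "\<forall>\<^sub>F n in sequentially. norm (?d n s - s) \<le> 1 / real (Suc n)"
    proof (rule always_eventually, rule allI)
      fix n
      have "?d n s - s = (real_of_int \<lfloor>real (Suc n) * s\<rfloor> - real (Suc n) * s) / real (Suc n)"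
        by (simp add: diff_divide_distrib del: of_nat_Suc)
      moreover have "\<bar>real_of_int \<lfloor>real (Suc n) * s\<rfloor> - real (Suc n) * s\<bar> \<le> 1"
        by linarith
      ultimately show "norm (?d n s - s) \<le> 1 / real (Suc n)"
        by (simp only: real_norm_def abs_divide abs_of_nat) (intro divide_right_mono, auto)
    qed
    show "(\<lambda>n. 1 / real (Suc n)) \<longlonglongrightarrow> 0"
      by (rule LIMSEQ_Suc[OF lim_1_over_n])
  qed
  ultimately show "(\<lambda>n. Z (?d n (fst x)) (snd x)) \<longlonglongrightarrow> Z (fst x) (snd x)"
    by (rule isCont_tendsto_compose)
qed

section \<open>Time integrals of a nonnegative continuous function\<close>

context
  fixes \<phi> :: "real \<Rightarrow> real"
  assumes cont: "continuous_on UNIV \<phi>" and nonneg: "\<And>s. 0 \<le> \<phi> s"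
begin

lemma integrable_on_interval: "\<phi> integrable_on {a..b}"
  using continuous_on_subset[OF cont] by (intro integrable_continuous_real) auto

lemma nn_integral_continuous_interval:
  "(\<integral>\<^sup>+s\<in>{a..b}. ennreal (\<phi> s) \<partial>lborel) = ennreal (integral {a..b} \<phi>)"
proof -
  have int: "set_integrable lborel {a..b} \<phi>"
    using continuous_on_subset[OF cont] by (intro borel_integrable_atLeastAtMost') auto
  have "(\<integral>\<^sup>+s\<in>{a..b}. ennreal (\<phi> s) \<partial>lborel) = (\<integral>\<^sup>+s. ennreal (indicat_real {a..b} s *\<^sub>R \<phi> s) \<partial>lborel)"
    by (intro nn_integral_cong) (simp split: split_indicator)
  also have "\<dots> = ennreal (LINT s:{a..b}|lborel. \<phi> s)"
    using int nonneg unfolding set_integrable_def set_lebesgue_integral_def by (intro nn_integral_eq_integral) auto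
  also have "(LINT s:{a..b}|lborel. \<phi> s) = integral {a..b} \<phi>"
    by (rule set_borel_integral_eq_integral(2)[OF int])
  finally show ?thesis .
qed

lemma integral_interval_mono: "0 \<le> s \<Longrightarrow> s \<le> t \<Longrightarrow> integral {0..s} \<phi> \<le> integral {0..t} \<phi>"
  by (rule integral_subset_le) (auto intro: integrable_on_interval nonneg)

text \<open>The intermediate value theorem gives a time \<open>u\<close> at which the running
  integral equals the truncated total. Up to \<open>u\<close> it has not passed \<open>R\<close>, so
  nothing is cut from the integrand there.\<close>

lemma truncated_integral_le:
  assumes "0 \<le> R" "0 \<le> t"
  shows "ennreal (min R (integral {0..t} \<phi>)) \<le>
    (\<integral>\<^sup>+s\<in>{0..t}. ennreal (if integral {0..s} \<phi> \<le> R then \<phi> s else 0) \<partial>lborel)"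
proof -
  have "continuous_on {0..t} (\<lambda>s. integral {0..s} \<phi>)"
    by (rule indefinite_integral_continuous_1[OF integrable_on_interval])
  moreover have "0 \<le> integral {0..t} \<phi>"
    using integral_interval_mono[of 0 t] assms by simp
  ultimately have "\<exists>u\<ge>0. u \<le> t \<and> integral {0..u} \<phi> = min R (integral {0..t} \<phi>)"
    using assms by (intro IVT') auto
  then obtain u where u: "0 \<le> u" "u \<le> t" "integral {0..u} \<phi> = min R (integral {0..t} \<phi>)"
    by blast
  have "ennreal (min R (integral {0..t} \<phi>)) = (\<integral>\<^sup>+s\<in>{0..u}. ennreal (\<phi> s) \<partial>lborel)"
    by (simp only: nn_integral_continuous_interval u(3))
  also have "\<dots> \<le> (\<integral>\<^sup>+s\<in>{0..t}. ennreal (if integral {0..s} \<phi> \<le> R then \<phi> s else 0) \<partial>lborel)"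
  proof (rule nn_integral_mono)
    fix s
    show "ennreal (\<phi> s) * indicator {0..u} s \<le> ennreal (if integral {0..s} \<phi> \<le> R then \<phi> s else 0) * indicator {0..t} s"
      using integral_interval_mono[of s u] u by (auto simp: indicator_def)
  qed
  finally show ?thesis .
qed

lemma integral_squared_le:
  assumes "0 \<le> t"
  shows "(integral {0..t} \<phi>)\<^sup>2 \<le> t * integral {0..t} (\<lambda>s. (\<phi> s)\<^sup>2)"
proof (cases "t = 0")
  case False
  define I where "I = integral {0..t} \<phi>"
  \<comment> \<open>The mean of \<open>\<phi>\<close> on \<open>[0,t]\<close>; expanding the
    integral of \<open>(\<phi> s - c)\<^sup>2\<close> yields Cauchy-Schwarz against the constant
    1.\<close>
  define c where "c = I / t"
  have int2: "(\<lambda>s. (\<phi> s)\<^sup>2) integrable_on {0..t}"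
    using continuous_on_subset[OF cont] by (intro integrable_continuous_real continuous_intros) auto
  have "0 \<le> integral {0..t} (\<lambda>s. (\<phi> s - c)\<^sup>2)"
    by (rule integral_nonneg) (use continuous_on_subset[OF cont] in \<open>auto intro!: integrable_continuous_real continuous_intros\<close>)
  also have "\<dots> = integral {0..t} (\<lambda>s. (\<phi> s)\<^sup>2 - 2 * c * \<phi> s + c\<^sup>2)"
    by (intro arg_cong[where f = "integral {0..t}"] ext) (simp add: power2_diff)
  also have "\<dots> = integral {0..t} (\<lambda>s. (\<phi> s)\<^sup>2) - 2 * c * I + t * c\<^sup>2"
  proof (rule integral_unique, intro has_integral_add has_integral_diff has_integral_mult_right)
    show "(\<phi> has_integral I) {0..t}"
      unfolding I_def by (rule integrable_integral[OF integrable_on_interval])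
    show "((\<lambda>s. c\<^sup>2) has_integral t * c\<^sup>2) {0..t}"
      using has_integral_const_real[of "c\<^sup>2" 0 t] assms by simp
  qed (rule integrable_integral[OF int2])
  also have "\<dots> = integral {0..t} (\<lambda>s. (\<phi> s)\<^sup>2) - I\<^sup>2 / t"
    using False by (simp add: c_def power2_eq_square field_simps)
  finally show ?thesis
    using False assms unfolding I_def[symmetric] by (simp add: divide_le_eq mult.commute)
qed simp

end

subsection \<open>Second moments of solutions\<close>

text \<open>Weighting by \<open>exp (- (2 * C * s))\<close> makes the inequality a contraction with
  factor 1/2 for the weighted supremum \<open>S\<close>, so \<open>S \<le> 1 + S / 2\<close>. The
  bound \<open>B\<close> makes \<open>S\<close> finite and is absent from the conclusion, so a
  truncation level can take its place.\<close>

lemma Gronwall_integral: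
  fixes w :: "real \<Rightarrow> real"
  assumes "0 < C"
    and bounded: "\<And>t. t \<in> {0..T} \<Longrightarrow> 0 \<le> w t \<and> w t \<le> B"
    and le: "\<And>t. t \<in> {0..T} \<Longrightarrow> ennreal (w t) \<le> (\<integral>\<^sup>+s\<in>{0..t}. ennreal (C * (1 + w s)) \<partial>lborel)"
    and t: "t \<in> {0..T}"
  shows "w t \<le> 2 * exp (2 * C * t)"
proof -
  define u where "u s = (1 + w s) * exp (- (2 * C * s))" for s
  define S where "S = (SUP s\<in>{0..T}. u s)"
  have bdd: "bdd_above (u ` {0..T})"
  proof (rule bdd_aboveI2)
    fix s assume "s \<in> {0..T}"
    then show "u s \<le> (1 + B) * 1"
      unfolding u_def using bounded[of s] \<open>0 < C\<close> by (intro mult_mono) auto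
  qed
  have uS: "u s \<le> S" if "s \<in> {0..T}" for s
    unfolding S_def by (rule cSUP_upper[OF that bdd])
  have wS: "1 + w s \<le> S * exp (2 * C * s)" if "s \<in> {0..T}" for s
    using uS[OF that] by (simp add: u_def exp_minus field_simps)
  have "0 \<le> S"
    using order.trans[OF _ uS[OF t], of 0] bounded[OF t] by (simp add: u_def)
  have half: "u s \<le> 1 + S / 2" if s: "s \<in> {0..T}" for s
  proof -
    have "ennreal (w s) \<le> (\<integral>\<^sup>+r. ennreal (C * (S * exp (2 * C * r))) * indicator {0..s} r \<partial>lborel)"
      using s wS \<open>0 < C\<close>
      by (intro order.trans[OF le[OF s]] nn_integral_mono)
         (auto simp: indicator_def intro!: ennreal_leI)
    also have "\<dots> = ennreal (S / 2 * exp (2 * C * s) - S / 2 * exp (2 * C * 0))"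
    proof (rule nn_integral_FTC_Icc)
      fix r
      show "((\<lambda>r. S / 2 * exp (2 * C * r)) has_real_derivative C * (S * exp (2 * C * r))) (at r)"
        by (rule derivative_eq_intros refl | simp)+
      show "0 \<le> C * (S * exp (2 * C * r))"
        using \<open>0 < C\<close> \<open>0 \<le> S\<close> by simp
    qed (use s in auto)
    also have "\<dots> \<le> ennreal (S / 2 * exp (2 * C * s))"
      using \<open>0 \<le> S\<close> by (intro ennreal_leI) simp
    finally have "w s \<le> S / 2 * exp (2 * C * s)"
      using \<open>0 \<le> S\<close> by (subst (asm) ennreal_le_iff) auto
    then have "(1 + w s) * exp (- (2 * C * s)) \<le> exp (- (2 * C * s)) + S / 2"
      by (simp add: exp_minus field_simps)
    also have "\<dots> \<le> 1 + S / 2" using s \<open>0 < C\<close> by simp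
    finally show ?thesis by (simp add: u_def)
  qed
  have "S \<le> 1 + S / 2"
    unfolding S_def by (rule cSUP_least) (use t half in \<open>auto simp: S_def\<close>)
  then have "S \<le> 2" by simp
  then show ?thesis
    using wS[OF t] mult_right_mono[OF \<open>S \<le> 2\<close>, of "exp (2 * C * t)"] by (smt (verit) exp_ge_zero)
qed

lemma three_term_square: "(a + b + c)\<^sup>2 \<le> 3 * a\<^sup>2 + 3 * b\<^sup>2 + 3 * (c :: real)\<^sup>2"
  using sum_squares_bound[of a b] sum_squares_bound[of b c] sum_squares_bound[of a c]
  by (simp add: power2_eq_square algebra_simps)

context brownian_setting
begin

text \<open>Paths are frozen outside \<open>[0,T]\<close> and set to 0 on a null set containing the
  discontinuous ones. Continuity of every path on the whole line is what joint measurability and the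
  running integral ask for.\<close>

lemma continuous_version:
  fixes X :: "real \<Rightarrow> 'w \<Rightarrow> 'b::euclidean_space"
  assumes meas: "\<And>t. t \<in> {0..T} \<Longrightarrow> X t \<in> borel_measurable M"
    and cont: "AE \<omega> in M. continuous_on {0..T} (\<lambda>t. X t \<omega>)"
  obtains X' where "\<And>t. X' t \<in> borel_measurable M" "\<And>\<omega>. continuous_on UNIV (\<lambda>t. X' t \<omega>)"
    "AE \<omega> in M. \<forall>t\<in>{0..T}. X' t \<omega> = X t \<omega>"
proof -
  obtain N where N: "N \<in> null_sets M" "{\<omega>\<in>space M. \<not> continuous_on {0..T} (\<lambda>t. X t \<omega>)} \<subseteq> N"
    using cont unfolding eventually_ae_filter by auto
  define X' where "X' t \<omega> = (if \<omega> \<in> N \<or> \<omega> \<notin> space M then 0 else X (max 0 (min T t)) \<omega>)" for t \<omega>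
  show thesis
  proof (rule that[of X'])
    show "X' t \<in> borel_measurable M" for t
    proof -
      have [measurable]: "X (max 0 (min T t)) \<in> borel_measurable M" "N \<in> sets M"
        using T_pos N by (auto intro!: meas)
      show ?thesis unfolding X'_def by measurable
    qed
    show "continuous_on UNIV (\<lambda>t. X' t \<omega>)" for \<omega>
    proof (cases "\<omega> \<in> N \<or> \<omega> \<notin> space M")
      case False
      then have "continuous_on {0..T} (\<lambda>t. X t \<omega>)" using N(2) by auto
      then have "continuous_on UNIV (\<lambda>t. X (max 0 (min T t)) \<omega>)"
        by (rule continuous_on_compose2) (use T_pos in \<open>auto intro!: continuous_intros\<close>)
      then show ?thesis using False by (simp add: X'_def)
    qed (simp add: X'_def)
    show "AE \<omega> in M. \<forall>t\<in>{0..T}. X' t \<omega> = X t \<omega>"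
      using AE_not_in[OF N(1)] AE_space by eventually_elim (auto simp: X'_def)
  qed
qed

text \<open>
  The clock \<open>Q t = \<integral>\<^sub>0\<^sup>t \<kappa>\<^sup>2 ds\<close> dominates drift and diffusion at once, so \<open>w t = \<E>[min R (Q t)]\<close>
  satisfies a Gronwall inequality whose constants do not depend on \<open>R\<close>; no exit time of \<open>X\<close> is needed.
\<close>

lemma linear_growth_second_moment:
  fixes X :: "real \<Rightarrow> 'w \<Rightarrow> real^'n" and H :: "real \<Rightarrow> 'w \<Rightarrow> real^'d^'n"
  assumes X_meas: "\<And>t. t \<in> {0..T} \<Longrightarrow> X t \<in> borel_measurable M"
    and X_cont: "AE \<omega> in M. continuous_on {0..T} (\<lambda>t. X t \<omega>)"
    and I: "ito_integral M T F W H Y"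
    and b_int: "AE \<omega> in M. set_integrable lborel {0..T} (\<lambda>s. b s \<omega>)"
    and X_eq: "AE \<omega> in M. \<forall>t\<in>{0..T}. X t \<omega> = x0 + (LINT s:{0..t}|lborel. b s \<omega>) + Y t \<omega>"
    and growth: "AE \<omega> in M. \<forall>s\<in>{0..T}. norm (b s \<omega>) \<le> L * (1 + norm (X s \<omega>)) \<and> norm (H s \<omega>) \<le> L * (1 + norm (X s \<omega>))"
    and L: "0 < L"
  defines "c \<equiv> 3 * (norm x0)\<^sup>2 + 3 * T + 9 * CARD('d)"
  shows "(\<integral>\<^sup>+\<omega>. ennreal ((norm (X T \<omega>))\<^sup>2) \<partial>M) \<le> ennreal (c * (1 + 2 * exp (2 * (2 * L\<^sup>2 * (1 + c)) * T)))"
proof -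
  obtain X' where X'_meas: "\<And>t. X' t \<in> borel_measurable M" and X'_cont: "\<And>\<omega>. continuous_on UNIV (\<lambda>t. X' t \<omega>)"
    and X'_eq: "AE \<omega> in M. \<forall>t\<in>{0..T}. X' t \<omega> = X t \<omega>"
    using continuous_version[OF X_meas X_cont] by blast
  define \<kappa> where "\<kappa> \<omega> s = L * (1 + norm (X' s \<omega>))" for \<omega> s
  define \<phi> where "\<phi> \<omega> s = (\<kappa> \<omega> s)\<^sup>2" for \<omega> s
  define Q where "Q \<omega> t = integral {0..t} (\<phi> \<omega>)" for \<omega> t
  have \<kappa>_cont: "continuous_on UNIV (\<kappa> \<omega>)" for \<omega>
    unfolding \<kappa>_def using X'_cont[of \<omega>] by (intro continuous_intros)
  have \<kappa>_nonneg: "0 \<le> \<kappa> \<omega> s" for \<omega> s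
    unfolding \<kappa>_def using L by simp
  have \<phi>_cont: "continuous_on UNIV (\<phi> \<omega>)" for \<omega>
    unfolding \<phi>_def using \<kappa>_cont[of \<omega>] by (intro continuous_intros)
  have \<phi>_nonneg: "0 \<le> \<phi> \<omega> s" for \<omega> s
    unfolding \<phi>_def by simp
  note \<phi>_facts = \<phi>_cont \<phi>_nonneg
  have Q_nonneg: "0 \<le> Q \<omega> t" for \<omega> t
    unfolding Q_def by (rule integral_nonneg[OF integrable_on_interval[OF \<phi>_facts]]) (rule \<phi>_nonneg)
  have c: "0 \<le> c" unfolding c_def using T_pos by simp
  have X'_joint: "(\<lambda>x. X' (fst x) (snd x)) \<in> borel_measurable (borel \<Otimes>\<^sub>M M)"
    by (rule borel_measurable_continuous_paths) (use X'_meas X'_cont in auto)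
  have \<phi>_joint[measurable]: "(\<lambda>x. \<phi> (snd x) (fst x)) \<in> borel_measurable (borel \<Otimes>\<^sub>M M)"
    unfolding \<phi>_def \<kappa>_def using X'_joint by measurable
  have \<phi>_joint'[measurable]: "(\<lambda>x. \<phi> (fst x) (snd x)) \<in> borel_measurable (M \<Otimes>\<^sub>M borel)"
    using measurable_compose[OF _ \<phi>_joint, of "\<lambda>x. (snd x, fst x)"] by simp
  have \<phi>_meas[measurable]: "(\<lambda>\<omega>. \<phi> \<omega> s) \<in> borel_measurable M" for s
    unfolding \<phi>_def \<kappa>_def using X'_meas[of s] by measurable
  have Q_meas[measurable]: "(\<lambda>\<omega>. Q \<omega> t) \<in> borel_measurable M" for t
  proof -
    have "(\<lambda>\<omega>. \<integral>\<^sup>+s\<in>{0..t}. ennreal (\<phi> \<omega> s) \<partial>lborel) \<in> borel_measurable M"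
      by (rule lborel.borel_measurable_nn_integral)
        (use \<phi>_joint' in \<open>simp add: case_prod_beta' cong: measurable_cong_sets\<close>)
    then have "(\<lambda>\<omega>. enn2real (\<integral>\<^sup>+s\<in>{0..t}. ennreal (\<phi> \<omega> s) \<partial>lborel)) \<in> borel_measurable M"
      by measurable
    then show ?thesis
      unfolding nn_integral_continuous_interval[OF \<phi>_facts] Q_def[symmetric]
      by (simp add: Q_nonneg)
  qed
  \<comment> \<open>Continuity of the clock comes from intervals starting at 0; clamping negative
    times extends it to the whole line, over which Fubini's theorem is applied.\<close>
  have Q_joint: "(\<lambda>x. Q (snd x) (max 0 (fst x))) \<in> borel_measurable (borel \<Otimes>\<^sub>M M)"
  proof (rule borel_measurable_continuous_paths[where Z = "\<lambda>s \<omega>. Q \<omega> (max 0 s)"])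
    fix \<omega>
    have "isCont (\<lambda>s. Q \<omega> (max 0 s)) s" for s
    proof (rule continuous_on_interior)
      have "continuous_on {0..\<bar>s\<bar> + 1} (Q \<omega>)"
        unfolding Q_def by (rule indefinite_integral_continuous_1[OF integrable_on_interval[OF \<phi>_facts]])
      then show "continuous_on {..<\<bar>s\<bar> + 1} (\<lambda>s. Q \<omega> (max 0 s))"
        by (rule continuous_on_compose2) (auto intro!: continuous_intros)
      show "s \<in> interior {..<\<bar>s\<bar> + 1}" by (simp add: interior_open)
    qed
    then show "continuous_on UNIV (\<lambda>s. Q \<omega> (max 0 s))"
      by (simp add: continuous_at_imp_continuous_on)
  qed measurable
  define w where "w R t = expectation (\<lambda>\<omega>. min R (Q \<omega> t))" for R t
  have min_int: "integrable M (\<lambda>\<omega>. min R (a * Q \<omega> t))" if "0 \<le> R" "0 \<le> a" for R a t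
    by (rule integrable_const_bound[where B = R]) (use that Q_nonneg in \<open>auto intro!: AE_I2\<close>)
  have w_bounds: "0 \<le> w R t" "w R t \<le> R" if "0 \<le> R" for R t
  proof -
    show "0 \<le> w R t" unfolding w_def using that Q_nonneg by (intro integral_nonneg_AE AE_I2) auto
    have "w R t \<le> expectation (\<lambda>\<omega>. R)"
      unfolding w_def using min_int[of R 1 t] that by (intro integral_mono) auto
    then show "w R t \<le> R" by (simp add: prob_space)
  qed
  \<comment> \<open>Cauchy-Schwarz on \<open>[0,t]\<close>, then \<open>t \<le> T\<close>; this is
    the origin of the summand \<open>3 * T\<close> in \<open>c\<close>.\<close>
  have drift: "AE \<omega> in M. \<forall>t\<in>{0..T}. (norm (LINT s:{0..t}|lborel. b s \<omega>))\<^sup>2 \<le> T * Q \<omega> t"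
    using b_int growth X'_eq
  proof eventually_elim
    case (elim \<omega>)
    show ?case
    proof
      fix t assume t: "t \<in> {0..T}"
      have \<kappa>_int: "set_integrable lborel {0..t} (\<kappa> \<omega>)"
        using continuous_on_subset[OF \<kappa>_cont] by (intro borel_integrable_atLeastAtMost') auto
      have "set_integrable lborel {0..t} (\<lambda>s. b s \<omega>)"
        by (rule set_integrable_subset[OF elim(1)]) (use t in auto)
      then have "norm (LINT s:{0..t}|lborel. b s \<omega>) \<le> (LINT s:{0..t}|lborel. norm (b s \<omega>))"
        by (rule set_integral_norm_bound)
      also have "\<dots> \<le> (LINT s:{0..t}|lborel. \<kappa> \<omega> s)"
        using \<open>set_integrable lborel {0..t} (\<lambda>s. b s \<omega>)\<close>
        by (intro set_integral_mono set_integrable_norm \<kappa>_int) (use t elim in \<open>auto simp: \<kappa>_def\<close>)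
      also have "\<dots> = integral {0..t} (\<kappa> \<omega>)"
        by (rule set_borel_integral_eq_integral(2)[OF \<kappa>_int])
      finally have "(norm (LINT s:{0..t}|lborel. b s \<omega>))\<^sup>2 \<le> (integral {0..t} (\<kappa> \<omega>))\<^sup>2"
        by (intro power_mono) auto
      also have "\<dots> \<le> t * Q \<omega> t"
        unfolding Q_def \<phi>_def using t by (intro integral_squared_le \<kappa>_cont \<kappa>_nonneg) auto
      also have "\<dots> \<le> T * Q \<omega> t"
        using t Q_nonneg by (intro mult_right_mono) auto
      finally show "(norm (LINT s:{0..t}|lborel. b s \<omega>))\<^sup>2 \<le> T * Q \<omega> t" .
    qed
  qed
  \<comment> \<open>Restricting to the event that the clock is within \<open>R\<close> gives a
    finite bound before \<open>X t\<close> is known to be square integrable.\<close>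
  have moment: "(\<integral>\<^sup>+\<omega>. (if Q \<omega> t \<le> R then ennreal ((norm (X t \<omega>))\<^sup>2) else 0) \<partial>M) \<le> ennreal (c * (1 + w R t))"
    if t: "t \<in> {0..T}" and R: "0 \<le> R" for t R
  proof -
    have HQ: "AE \<omega> in M. (\<integral>\<^sup>+s\<in>{0..t}. ennreal ((norm (H s \<omega>))\<^sup>2) \<partial>lborel) \<le> ennreal (Q \<omega> t)"
      using growth X'_eq
    proof eventually_elim
      case (elim \<omega>)
      have "(\<integral>\<^sup>+s\<in>{0..t}. ennreal ((norm (H s \<omega>))\<^sup>2) \<partial>lborel) \<le> (\<integral>\<^sup>+s\<in>{0..t}. ennreal (\<phi> \<omega> s) \<partial>lborel)"
        by (intro nn_integral_mono)
          (use elim t in \<open>auto simp: \<phi>_def \<kappa>_def indicator_def intro!: ennreal_leI power_mono\<close>)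
      then show ?case
        unfolding nn_integral_continuous_interval[OF \<phi>_facts] Q_def .
    qed
    \<comment> \<open>The level is \<open>2 * R + 1\<close> because
      \<open>Q \<omega> t \<le> R\<close> must imply the strict inequality in the localised
      estimate.\<close>
    obtain Z where [measurable]: "Z \<in> borel_measurable M"
      and Z: "AE \<omega> in M. 2 * Q \<omega> t < 2 * R + 1 \<longrightarrow> ennreal ((norm (Y t \<omega>))\<^sup>2) \<le> Z \<omega>"
      and Z_int: "(\<integral>\<^sup>+\<omega>. Z \<omega> \<partial>M) \<le> ennreal (CARD('d) * expectation (\<lambda>\<omega>. min (2 * R + 1) (2 * Q \<omega> t)))"
      using ito_integral_localised[OF I t Q_meas Q_nonneg HQ, of "2 * R + 1"] R by auto
    have "AE \<omega> in M. (if Q \<omega> t \<le> R then ennreal ((norm (X t \<omega>))\<^sup>2) else 0) \<le>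
      ennreal (3 * (norm x0)\<^sup>2 + 3 * T * min R (Q \<omega> t)) + 3 * Z \<omega>"
      using Z drift X_eq
    proof eventually_elim
      case (elim \<omega>)
      show ?case
      proof (cases "Q \<omega> t \<le> R")
        case True
        let ?I = "LINT s:{0..t}|lborel. b s \<omega>"
        have "norm (X t \<omega>) \<le> norm x0 + norm ?I + norm (Y t \<omega>)"
          using elim(3) t norm_triangle_ineq[of "x0 + ?I" "Y t \<omega>"] norm_triangle_ineq[of x0 ?I] by auto
        then have "(norm (X t \<omega>))\<^sup>2 \<le> (norm x0 + norm ?I + norm (Y t \<omega>))\<^sup>2"
          by (intro power_mono) auto
        also have "\<dots> \<le> 3 * (norm x0)\<^sup>2 + 3 * (norm ?I)\<^sup>2 + 3 * (norm (Y t \<omega>))\<^sup>2"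
          by (rule three_term_square)
        also have "\<dots> \<le> (3 * (norm x0)\<^sup>2 + 3 * T * min R (Q \<omega> t)) + 3 * (norm (Y t \<omega>))\<^sup>2"
          using elim(2) t True by (auto simp: min_def)
        finally have "ennreal ((norm (X t \<omega>))\<^sup>2) \<le> ennreal ((3 * (norm x0)\<^sup>2 + 3 * T * min R (Q \<omega> t)) + 3 * (norm (Y t \<omega>))\<^sup>2)"
          by (rule ennreal_leI)
        also have "\<dots> = ennreal (3 * (norm x0)\<^sup>2 + 3 * T * min R (Q \<omega> t)) + 3 * ennreal ((norm (Y t \<omega>))\<^sup>2)"
          using T_pos R Q_nonneg[of \<omega> t] by (simp add: ennreal_plus ennreal_mult)
        also have "\<dots> \<le> ennreal (3 * (norm x0)\<^sup>2 + 3 * T * min R (Q \<omega> t)) + 3 * Z \<omega>"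
          using elim(1) True by (intro add_left_mono mult_left_mono) auto
        finally show ?thesis using True by simp
      qed simp
    qed
    then have "(\<integral>\<^sup>+\<omega>. (if Q \<omega> t \<le> R then ennreal ((norm (X t \<omega>))\<^sup>2) else 0) \<partial>M) \<le>
        (\<integral>\<^sup>+\<omega>. ennreal (3 * (norm x0)\<^sup>2 + 3 * T * min R (Q \<omega> t)) + 3 * Z \<omega> \<partial>M)"
      by (rule nn_integral_mono_AE)
    also have "\<dots> = (\<integral>\<^sup>+\<omega>. ennreal (3 * (norm x0)\<^sup>2 + 3 * T * min R (Q \<omega> t)) \<partial>M) + 3 * (\<integral>\<^sup>+\<omega>. Z \<omega> \<partial>M)"
      by (subst nn_integral_add) (measurable, simp add: nn_integral_cmult)
    also have "(\<integral>\<^sup>+\<omega>. ennreal (3 * (norm x0)\<^sup>2 + 3 * T * min R (Q \<omega> t)) \<partial>M) = ennreal (3 * (norm x0)\<^sup>2 + 3 * T * w R t)"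
    proof (subst nn_integral_eq_integral)
      show "integrable M (\<lambda>\<omega>. 3 * (norm x0)\<^sup>2 + 3 * T * min R (Q \<omega> t))"
        using min_int[of R 1 t] R by auto
      show "ennreal (expectation (\<lambda>\<omega>. 3 * (norm x0)\<^sup>2 + 3 * T * min R (Q \<omega> t))) = ennreal (3 * (norm x0)\<^sup>2 + 3 * T * w R t)"
        using min_int[of R 1 t] R by (simp add: w_def prob_space)
    qed (use R T_pos Q_nonneg in \<open>auto intro!: AE_I2\<close>)
    \<comment> \<open>Doubling the level inside the minimum costs a factor 2 and an additive 1. With
      the factor 3 from the three-term square, the total is covered by
      \<open>9 * CARD('d) * (1 + w R t)\<close>.\<close>
    also have "(\<integral>\<^sup>+\<omega>. Z \<omega> \<partial>M) \<le> ennreal (CARD('d) * (2 * w R t + 1))"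
    proof (rule order.trans[OF Z_int], intro ennreal_leI mult_left_mono)
      have "expectation (\<lambda>\<omega>. min (2 * R + 1) (2 * Q \<omega> t)) \<le> expectation (\<lambda>\<omega>. 2 * min R (Q \<omega> t) + 1)"
        using min_int[of "2 * R + 1" 2 t] min_int[of R 1 t] R by (intro integral_mono) auto
      then show "expectation (\<lambda>\<omega>. min (2 * R + 1) (2 * Q \<omega> t)) \<le> 2 * w R t + 1"
        using min_int[of R 1 t] R by (simp add: w_def prob_space)
    qed simp
    also have "ennreal (3 * (norm x0)\<^sup>2 + 3 * T * w R t) + 3 * ennreal (CARD('d) * (2 * w R t + 1)) =
        ennreal (3 * (norm x0)\<^sup>2 + 3 * T * w R t + 3 * (CARD('d) * (2 * w R t + 1)))"
      using w_bounds[OF R, of t] T_pos by (simp add: ennreal_plus ennreal_mult)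
    also have "\<dots> \<le> ennreal (c * (1 + w R t))"
      using w_bounds[OF R, of t] T_pos by (intro ennreal_leI) (simp add: c_def algebra_simps)
    finally show ?thesis
      by (simp add: add_left_mono mult_left_mono)
  qed
  \<comment> \<open>The factor \<open>2 * L\<^sup>2\<close> comes from bounding the square of
    \<open>1 + norm (X s \<omega>)\<close>, and \<open>1 + c\<close> from inserting the moment
    estimate.\<close>
  define C where "C = 2 * L\<^sup>2 * (1 + c)"
  have C: "0 < C" unfolding C_def using L c by simp
  have w_le: "w R t \<le> 2 * exp (2 * C * t)" if t: "t \<in> {0..T}" and R: "0 \<le> R" for t R
  proof (rule Gronwall_integral[OF C _ _ t])
    show "0 \<le> w R t \<and> w R t \<le> R" for t using w_bounds[OF R] by simp
    fix t assume t: "t \<in> {0..T}"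
    have inner: "(\<integral>\<^sup>+\<omega>. ennreal (if Q \<omega> s \<le> R then \<phi> \<omega> s else 0) \<partial>M) \<le> ennreal (C * (1 + w R s))"
      if s: "s \<in> {0..T}" for s
    proof -
      have [measurable]: "X s \<in> borel_measurable M" by (rule X_meas[OF s])
      have "AE \<omega> in M. ennreal (if Q \<omega> s \<le> R then \<phi> \<omega> s else 0) \<le>
          ennreal (2 * L\<^sup>2) + ennreal (2 * L\<^sup>2) * (if Q \<omega> s \<le> R then ennreal ((norm (X s \<omega>))\<^sup>2) else 0)"
        using X'_eq
      proof eventually_elim
        case (elim \<omega>)
        have "\<phi> \<omega> s = L\<^sup>2 * (1 + norm (X s \<omega>))\<^sup>2"
          using elim s by (simp add: \<phi>_def \<kappa>_def power_mult_distrib)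
        also have "\<dots> \<le> L\<^sup>2 * (2 + 2 * (norm (X s \<omega>))\<^sup>2)"
          using sum_squares_bound[of 1 "norm (X s \<omega>)"] by (intro mult_left_mono) (auto simp: power2_sum)
        finally have "ennreal (\<phi> \<omega> s) \<le> ennreal (2 * L\<^sup>2 + 2 * L\<^sup>2 * (norm (X s \<omega>))\<^sup>2)"
          by (intro ennreal_leI) (simp add: algebra_simps)
        also have "\<dots> = ennreal (2 * L\<^sup>2) + ennreal (2 * L\<^sup>2) * ennreal ((norm (X s \<omega>))\<^sup>2)"
          by (subst ennreal_plus) (auto simp: ennreal_mult)
        finally show ?case by simp
      qed
      then have "(\<integral>\<^sup>+\<omega>. ennreal (if Q \<omega> s \<le> R then \<phi> \<omega> s else 0) \<partial>M) \<le>
          (\<integral>\<^sup>+\<omega>. ennreal (2 * L\<^sup>2) + ennreal (2 * L\<^sup>2) * (if Q \<omega> s \<le> R then ennreal ((norm (X s \<omega>))\<^sup>2) else 0) \<partial>M)"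
        by (rule nn_integral_mono_AE)
      also have "\<dots> = ennreal (2 * L\<^sup>2) + ennreal (2 * L\<^sup>2) * (\<integral>\<^sup>+\<omega>. (if Q \<omega> s \<le> R then ennreal ((norm (X s \<omega>))\<^sup>2) else 0) \<partial>M)"
        by (subst nn_integral_add) (measurable, simp add: nn_integral_cmult emeasure_space_1)
      also have "\<dots> \<le> ennreal (2 * L\<^sup>2) + ennreal (2 * L\<^sup>2) * ennreal (c * (1 + w R s))"
        by (intro add_left_mono mult_left_mono moment[OF s R]) auto
      also have "\<dots> = ennreal (2 * L\<^sup>2 + 2 * L\<^sup>2 * (c * (1 + w R s)))"
        using w_bounds[OF R, of s] c by (simp add: ennreal_plus ennreal_mult)
      also have "\<dots> \<le> ennreal (C * (1 + w R s))"
        using w_bounds[OF R, of s] by (intro ennreal_leI) (simp add: C_def algebra_simps)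
      finally show ?thesis .
    qed
    have "ennreal (w R t) = (\<integral>\<^sup>+\<omega>. ennreal (min R (Q \<omega> t)) \<partial>M)"
      unfolding w_def using min_int[of R 1 t] R Q_nonneg by (intro nn_integral_eq_integral[symmetric]) auto
    also have "\<dots> \<le> (\<integral>\<^sup>+\<omega>. (\<integral>\<^sup>+s\<in>{0..t}. ennreal (if Q \<omega> s \<le> R then \<phi> \<omega> s else 0) \<partial>lborel) \<partial>M)"
      unfolding Q_def using t by (intro nn_integral_mono truncated_integral_le[OF \<phi>_facts R]) auto
    \<comment> \<open>The clamp changes nothing on \<open>[0,t]\<close> and brings the integrand
      into the jointly measurable form.\<close>
    also have "\<dots> = (\<integral>\<^sup>+\<omega>. (\<integral>\<^sup>+s. ennreal (if Q \<omega> (max 0 s) \<le> R then \<phi> \<omega> s else 0) * indicator {0..t} s \<partial>lborel) \<partial>M)"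
      by (intro nn_integral_cong) (simp split: split_indicator)
    also have "\<dots> = (\<integral>\<^sup>+s. (\<integral>\<^sup>+\<omega>. ennreal (if Q \<omega> (max 0 s) \<le> R then \<phi> \<omega> s else 0) * indicator {0..t} s \<partial>M) \<partial>lborel)"
    proof (rule pair_sigma_finite.Fubini'[where f = "\<lambda>s \<omega>. ennreal (if Q \<omega> (max 0 s) \<le> R then \<phi> \<omega> s else 0) * indicator {0..t} s"])
      show "pair_sigma_finite lborel M"
        by (intro pair_sigma_finite.intro lborel.sigma_finite_measure_axioms sigma_finite_measure_axioms)
      have "(\<lambda>x. ennreal (if Q (snd x) (max 0 (fst x)) \<le> R then \<phi> (snd x) (fst x) else 0) * indicator {0..t} (fst x))
          \<in> borel_measurable (borel \<Otimes>\<^sub>M M)"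
        using Q_joint \<phi>_joint by measurable
      then show "(\<lambda>(s, \<omega>). ennreal (if Q \<omega> (max 0 s) \<le> R then \<phi> \<omega> s else 0) * indicator {0..t} s)
          \<in> borel_measurable (lborel \<Otimes>\<^sub>M M)"
        by (simp add: case_prod_beta' cong: measurable_cong_sets)
    qed
    also have "\<dots> \<le> (\<integral>\<^sup>+s\<in>{0..t}. ennreal (C * (1 + w R s)) \<partial>lborel)"
      by (intro nn_integral_mono) (use t inner in \<open>auto simp: indicator_def max_def\<close>)
    finally show "ennreal (w R t) \<le> (\<integral>\<^sup>+s\<in>{0..t}. ennreal (C * (1 + w R s)) \<partial>lborel)" .
  qed
  have T_in: "T \<in> {0..T}" using T_pos by simp
  note [measurable] = X_meas[OF T_in]
  \<comment> \<open>The truncation is removed: each \<open>\<omega>\<close> eventually satisfies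
    \<open>Q \<omega> T \<le> real n\<close>, and the bound is the same for all
    \<open>n\<close>.\<close>
  let ?f = "\<lambda>n \<omega>. if Q \<omega> T \<le> real n then ennreal ((norm (X T \<omega>))\<^sup>2) else 0"
  have "(\<integral>\<^sup>+\<omega>. ennreal ((norm (X T \<omega>))\<^sup>2) \<partial>M) = (\<integral>\<^sup>+\<omega>. liminf (\<lambda>n. ?f n \<omega>) \<partial>M)"
  proof (rule nn_integral_cong)
    fix \<omega>
    obtain m where "Q \<omega> T \<le> real m" using real_arch_simple by blast
    then have "\<forall>\<^sub>F n in sequentially. ?f n \<omega> = ennreal ((norm (X T \<omega>))\<^sup>2)"
      by (intro eventually_sequentiallyI[of m]) auto
    from lim_imp_Liminf[OF trivial_limit_sequentially tendsto_eventually[OF this]]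
    show "ennreal ((norm (X T \<omega>))\<^sup>2) = liminf (\<lambda>n. ?f n \<omega>)" by simp
  qed
  also have "\<dots> \<le> liminf (\<lambda>n. \<integral>\<^sup>+\<omega>. ?f n \<omega> \<partial>M)"
    by (rule nn_integral_liminf) measurable
  also have "\<dots> \<le> liminf (\<lambda>n::nat. ennreal (c * (1 + 2 * exp (2 * C * T))))"
    by (intro Liminf_mono always_eventually allI order.trans[OF moment[OF T_in]] ennreal_leI mult_left_mono add_left_mono w_le T_in c) auto
  also have "\<dots> = ennreal (c * (1 + 2 * exp (2 * C * T)))"
    by (rule Liminf_const) simp
  finally show ?thesis unfolding C_def .
qed

end

section \<open>Admissible controls and moment bounds uniform over them\<close>

context brownian_setting
begin

text \<open>\<open>C\<close> is fixed before the control. On a bounded control set the term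
  \<open>norm a\<close> is absorbed into the growth constant \<open>L = K * (1 + r)\<close>, so the
  moment estimate involves only \<open>L\<close>, \<open>T\<close>, \<open>x0\<close> and the
  dimension of the noise.\<close>

lemma strong_solution_second_moment_bounded:
  fixes \<mu> :: "real^'n \<Rightarrow> 'e::euclidean_space \<Rightarrow> real^'n" and \<sigma> :: "real^'n \<Rightarrow> 'e \<Rightarrow> real^'d^'n"
  assumes S: "bounded S" and K: "0 < K"
    and growth: "\<And>x a. a \<in> S \<Longrightarrow> norm (\<mu> x a) + norm (\<sigma> x a) \<le> K * (1 + norm x + norm a)"
  obtains C where "0 \<le> C"
    "\<And>A X. A \<in> controls M T F S \<Longrightarrow> strong_solution M T F W \<mu> \<sigma> x0 A X \<Longrightarrow>
      (\<integral>\<^sup>+\<omega>. ennreal ((norm (X T \<omega>))\<^sup>2) \<partial>M) \<le> ennreal C"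
proof -
  obtain r where r: "0 < r" "\<And>a. a \<in> S \<Longrightarrow> norm a \<le> r"
    using S unfolding bounded_pos by auto
  define L where "L = K * (1 + r)"
  have L: "0 < L" unfolding L_def using K r by simp
  have growth': "norm (\<mu> x a) \<le> L * (1 + norm x) \<and> norm (\<sigma> x a) \<le> L * (1 + norm x)" if "a \<in> S" for x a
  proof -
    have "1 + norm x + norm a \<le> (1 + r) * (1 + norm x)"
      using r(1) r(2)[OF that] mult_nonneg_nonneg[OF less_imp_le[OF r(1)] norm_ge_zero[of x]]
      unfolding distrib_left distrib_right by linarith
    then have "norm (\<mu> x a) + norm (\<sigma> x a) \<le> L * (1 + norm x)"
      using growth[OF that, of x] K unfolding L_def mult.assoc
      by (meson mult_left_mono less_imp_le order.trans)
    then show ?thesis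
      using norm_ge_zero[of "\<mu> x a"] norm_ge_zero[of "\<sigma> x a"] by linarith
  qed
  define c where "c = 3 * (norm x0)\<^sup>2 + 3 * T + 9 * CARD('d)"
  show thesis
  proof (rule that[of "c * (1 + 2 * exp (2 * (2 * L\<^sup>2 * (1 + c)) * T))"])
    show "0 \<le> c * (1 + 2 * exp (2 * (2 * L\<^sup>2 * (1 + c)) * T))"
      unfolding c_def using T_pos by (intro mult_nonneg_nonneg) (auto intro!: add_nonneg_nonneg)
    fix A X
    assume A: "A \<in> controls M T F S" and X: "strong_solution M T F W \<mu> \<sigma> x0 A X"
    obtain Y where Y: "ito_integral M T F W (\<lambda>s \<omega>. \<sigma> (X s \<omega>) (A s \<omega>)) Y"
      "AE \<omega> in M. \<forall>t\<in>{0..T}. X t \<omega> = x0 + (LINT s:{0..t}|lborel. \<mu> (X s \<omega>) (A s \<omega>)) + Y t \<omega>"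
      using X unfolding strong_solution_def by blast
    have "AE \<omega> in M. \<forall>s\<in>{0..T}. A s \<omega> \<in> S"
      using A by (simp add: controls_def)
    then have "AE \<omega> in M. \<forall>s\<in>{0..T}. norm (\<mu> (X s \<omega>) (A s \<omega>)) \<le> L * (1 + norm (X s \<omega>)) \<and>
        norm (\<sigma> (X s \<omega>) (A s \<omega>)) \<le> L * (1 + norm (X s \<omega>))"
      by eventually_elim (use growth' in blast)
    moreover have "X t \<in> borel_measurable M" if "t \<in> {0..T}" for t
      by (rule measurable_F_imp_M[OF _ that]) (use X that in \<open>simp add: strong_solution_def\<close>)
    moreover have "AE \<omega> in M. continuous_on {0..T} (\<lambda>t. X t \<omega>)"
      "AE \<omega> in M. set_integrable lborel {0..T} (\<lambda>s. \<mu> (X s \<omega>) (A s \<omega>))"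
      using X by (simp_all add: strong_solution_def)
    ultimately show "(\<integral>\<^sup>+\<omega>. ennreal ((norm (X T \<omega>))\<^sup>2) \<partial>M) \<le>
        ennreal (c * (1 + 2 * exp (2 * (2 * L\<^sup>2 * (1 + c)) * T)))"
      unfolding c_def using Y L by (intro linear_growth_second_moment)
  qed
qed

text \<open>Makes the mixed control of the joint convexity hypothesis a competitor in the
  infimum.\<close>

lemma controls_convex_combination:
  fixes S :: "'e::euclidean_space set"
  assumes A: "A \<in> controls M T F S" and B: "B \<in> controls M T F S" and S: "convex S" and \<theta>: "\<theta> \<in> {0..1}"
  shows "(\<lambda>t \<omega>. \<theta> *\<^sub>R A t \<omega> + (1 - \<theta>) *\<^sub>R B t \<omega>) \<in> controls M T F S"
proof -
  have "prog_measurable T F (\<lambda>t \<omega>. \<theta> *\<^sub>R A t \<omega> + (1 - \<theta>) *\<^sub>R B t \<omega>)"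
    unfolding prog_measurable_def case_prod_beta'
  proof
    fix t assume "t \<in> {0..T}"
    then have [measurable]: "(\<lambda>x. A (fst x) (snd x)) \<in> borel_measurable (restrict_space borel {0..t} \<Otimes>\<^sub>M F t)"
      "(\<lambda>x. B (fst x) (snd x)) \<in> borel_measurable (restrict_space borel {0..t} \<Otimes>\<^sub>M F t)"
      using A B unfolding controls_def prog_measurable_def case_prod_beta' by blast+
    show "(\<lambda>x. \<theta> *\<^sub>R A (fst x) (snd x) + (1 - \<theta>) *\<^sub>R B (fst x) (snd x)) \<in>
        borel_measurable (restrict_space borel {0..t} \<Otimes>\<^sub>M F t)"
      by measurable
  qed
  moreover have "AE \<omega> in M. \<forall>t\<in>{0..T}. \<theta> *\<^sub>R A t \<omega> + (1 - \<theta>) *\<^sub>R B t \<omega> \<in> S"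
  proof -
    have "AE \<omega> in M. \<forall>t\<in>{0..T}. A t \<omega> \<in> S" "AE \<omega> in M. \<forall>t\<in>{0..T}. B t \<omega> \<in> S"
      using A B by (simp_all add: controls_def)
    then show ?thesis
      by eventually_elim (use \<theta> in \<open>auto intro!: convexD[OF S]\<close>)
  qed
  ultimately show ?thesis by (simp add: controls_def)
qed

end

subsection \<open>Differentiability of the value function\<close>

text \<open>Integrability accompanies the derivative because the Bochner integral of a
  non-integrable function is 0 by convention.\<close>

theorem theorem3:
  fixes M :: "'w measure" and T K :: real and F :: "real \<Rightarrow> 'w measure"
    and W :: "real \<Rightarrow> 'w \<Rightarrow> real^'d"
    and \<AA> :: "'e::euclidean_space set"
    and \<mu> :: "real^'n \<Rightarrow> 'e \<Rightarrow> real^'n" and \<sigma> :: "real^'n \<Rightarrow> 'e \<Rightarrow> real^'d^'n"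
    and x0 :: "real^'n"
    and X :: "(real \<Rightarrow> 'w \<Rightarrow> 'e) \<Rightarrow> real \<Rightarrow> 'w \<Rightarrow> real^'n"
    and f :: "real \<times> (real^'m) \<Rightarrow> real" and g :: "real^'n \<Rightarrow> real"
    and A :: "real \<Rightarrow> 'w \<Rightarrow> 'e" and y :: "real^'m"
  assumes "0 < T"
    and "prob_space M"
    and "usual_filtration M T F"
    and "brownian_motion M T F W"
    and "compact \<AA>"
    and "continuous_on (UNIV \<times> \<AA>) (\<lambda>(x, a). \<mu> x a)"
    and "continuous_on (UNIV \<times> \<AA>) (\<lambda>(x, a). \<sigma> x a)"
    and "0 < K"
    and "\<forall>x x'. \<forall>a\<in>\<AA>. norm (\<mu> x a - \<mu> x' a) + norm (\<sigma> x a - \<sigma> x' a) \<le> K * norm (x - x')"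
    and "\<forall>x. \<forall>a\<in>\<AA>. norm (\<mu> x a) + norm (\<sigma> x a) \<le> K * (1 + norm x + norm a)"
    and "\<forall>B\<in>controls M T F \<AA>. strong_solution M T F W \<mu> \<sigma> x0 B (X B)"
    and "convex_on UNIV f"
    and "\<exists>C. \<forall>z. \<bar>f z\<bar> \<le> C * (1 + (norm z)\<^sup>2)"
    and "convex_on UNIV g"
    and "\<exists>L. lipschitz_on L UNIV g"
    and "\<exists>m>0. \<forall>x v \<xi>.
           f (x, v + \<xi>) \<le> f (x, v) + \<xi> \<bullet> gradient (\<lambda>u. f (x, u)) v + 1/2 * m * (norm \<xi>)\<^sup>2"
    and "convex \<AA>"
    and "\<forall>B\<in>controls M T F \<AA>. \<forall>B'\<in>controls M T F \<AA>. \<forall>v v'. \<forall>\<theta>\<in>{0..1}.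
           AE \<omega> in M.
             f (g (X (\<lambda>t \<omega>. \<theta> *\<^sub>R B t \<omega> + (1 - \<theta>) *\<^sub>R B' t \<omega>) T \<omega>), \<theta> *\<^sub>R v + (1 - \<theta>) *\<^sub>R v')
             \<le> \<theta> * f (g (X B T \<omega>), v) + (1 - \<theta>) * f (g (X B' T \<omega>), v')"
    and "A \<in> controls M T F \<AA>"
    and "value_function M T (controls M T F \<AA>) X f g y = (LINT \<omega>|M. f (g (X A T \<omega>), y))"
  shows "integrable M (\<lambda>\<omega>. gradient (\<lambda>u. f (g (X A T \<omega>), u)) y) \<and>
    GDERIV (value_function M T (controls M T F \<AA>) X f g) y :>
      (LINT \<omega>|M. gradient (\<lambda>u. f (g (X A T \<omega>), u)) y)"
proof -
  interpret brownian_setting M T F W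
    using assms(1-4) by (intro brownian_setting.intro brownian_setting_axioms.intro)
  define \<A> where "\<A> = controls M T F \<AA>"
  have A: "A \<in> \<A>" unfolding \<A>_def by fact
  have f_cont: "continuous_on UNIV f"
    by (rule convex_on_continuous[OF open_UNIV assms(12)])
  have f_sec[measurable]: "(\<lambda>x. f (x, v)) \<in> borel_measurable borel" for v
    by (intro borel_measurable_continuous_onI continuous_on_compose2[OF f_cont] continuous_intros) auto
  obtain Lg where Lg: "lipschitz_on Lg UNIV g" using assms(15) by blast
  have [measurable]: "g \<in> borel_measurable borel"
    by (rule borel_measurable_continuous_onI[OF lipschitz_on_continuous_on[OF Lg]])
  obtain Cf where Cf: "\<And>z. \<bar>f z\<bar> \<le> Cf * (1 + (norm z)\<^sup>2)" using assms(13) by blast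
  have "0 \<le> Cf" using Cf[of 0] by simp
  have f_le: "\<bar>f (x, v)\<bar> \<le> Cf * (1 + x\<^sup>2 + (norm v)\<^sup>2)" for x v
    using Cf[of "(x, v)"] by (simp add: norm_Pair add.assoc)
  obtain m where m: "0 < m" and
    semiconcave: "\<And>x v \<xi>. f (x, v + \<xi>) \<le> f (x, v) + \<xi> \<bullet> gradient (\<lambda>u. f (x, u)) v + 1/2 * m * (norm \<xi>)\<^sup>2"
    using assms(16) by blast
  have X_meas[measurable]: "X B T \<in> borel_measurable M" if "B \<in> \<A>" for B
    by (rule measurable_F_imp_M[of _ T])
      (use assms(11) that T_pos in \<open>auto simp: \<A>_def strong_solution_def\<close>)
  obtain C where C: "0 \<le> C" "\<And>B. B \<in> \<A> \<Longrightarrow> (\<integral>\<^sup>+\<omega>. ennreal ((norm (X B T \<omega>))\<^sup>2) \<partial>M) \<le> ennreal C"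
    using strong_solution_second_moment_bounded[OF compact_imp_bounded[OF assms(5)] assms(8), of \<mu> \<sigma> x0]
      assms(10,11) unfolding \<A>_def by metis
  have X_int: "integrable M (\<lambda>\<omega>. (norm (X B T \<omega>))\<^sup>2)" and X_le: "expectation (\<lambda>\<omega>. (norm (X B T \<omega>))\<^sup>2) \<le> C"
    if "B \<in> \<A>" for B
  proof -
    show int: "integrable M (\<lambda>\<omega>. (norm (X B T \<omega>))\<^sup>2)"
      using X_meas[OF that] order.strict_trans1[OF C(2)[OF that] ennreal_less_top]
      by (intro integrableI_bounded) auto
    have "ennreal (expectation (\<lambda>\<omega>. (norm (X B T \<omega>))\<^sup>2)) \<le> ennreal C"
      using C(2)[OF that] int by (subst (asm) nn_integral_eq_integral) auto
    then show "expectation (\<lambda>\<omega>. (norm (X B T \<omega>))\<^sup>2) \<le> C"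
      using C(1) by (simp add: ennreal_le_iff)
  qed
  define \<beta> where "\<beta> = 1 + 2 * (g 0)\<^sup>2"
  have g_le: "1 + (g x)\<^sup>2 \<le> \<beta> + 2 * Lg\<^sup>2 * (norm x)\<^sup>2" for x
  proof -
    have "\<bar>g x - g 0\<bar> \<le> Lg * norm x"
      using lipschitz_onD[OF Lg, of x 0] by (simp add: dist_norm)
    then have "\<bar>g x\<bar> \<le> \<bar>g 0\<bar> + Lg * norm x" by linarith
    then have "(g x)\<^sup>2 \<le> (\<bar>g 0\<bar> + Lg * norm x)\<^sup>2"
      by (metis abs_ge_zero power2_abs power_mono)
    then show ?thesis
      using sum_squares_bound[of "\<bar>g 0\<bar>" "Lg * norm x"] by (simp add: \<beta>_def power2_sum power_mult_distrib)
  qed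
  \<comment> \<open>A majorant quadratic in \<open>x\<close>: its expectation along
    \<open>X B T\<close> is finite and bounded uniformly in \<open>B\<close>.\<close>
  define bd where "bd v x = Cf * (\<beta> + 2 * Lg\<^sup>2 * (norm x)\<^sup>2 + (norm v)\<^sup>2)" for v :: "real^'m" and x :: "real^'n"
  have f_bd: "\<bar>f (g x, v)\<bar> \<le> bd v x" for x v
    unfolding bd_def using g_le[of x] \<open>0 \<le> Cf\<close> by (intro order.trans[OF f_le] mult_left_mono) auto
  have bd_int: "integrable M (\<lambda>\<omega>. bd v (X B T \<omega>))" if "B \<in> \<A>" for v B
    unfolding bd_def using X_int[OF that] by auto
  define \<Phi> where "\<Phi> B v = expectation (\<lambda>\<omega>. f (g (X B T \<omega>), v))" for B v
  have f_int: "integrable M (\<lambda>\<omega>. f (g (X B T \<omega>), v))" if "B \<in> \<A>" for B v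
    by (rule Bochner_Integration.integrable_bound[OF bd_int[OF that, of v]])
      (use f_bd[of _ v] X_meas[OF that] in \<open>auto intro!: AE_I2 simp: order.trans[OF _ abs_ge_self]\<close>)
  define V where "V = value_function M T \<A> X f g"
  have V_eq: "V v = (INF B\<in>\<A>. \<Phi> B v)" for v
    by (simp add: V_def value_function_def \<Phi>_def)
  \<comment> \<open>The uniformity of \<open>C\<close> over the controls is used here, to make the
    real infimum a greatest lower bound.\<close>
  have bdd: "bdd_below ((\<lambda>B. \<Phi> B v) ` \<A>)" for v
  proof (rule bdd_belowI2)
    fix B assume B: "B \<in> \<A>"
    have "- \<Phi> B v \<le> expectation (\<lambda>\<omega>. bd v (X B T \<omega>))"
      unfolding \<Phi>_def Bochner_Integration.integral_minus[symmetric]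
      using f_bd[of _ v] by (intro integral_mono bd_int f_int B Bochner_Integration.integrable_minus) (simp add: abs_le_iff)
    also have "\<dots> \<le> Cf * (\<beta> + 2 * Lg\<^sup>2 * C + (norm v)\<^sup>2)"
      unfolding bd_def using X_int[OF B] X_le[OF B] \<open>0 \<le> Cf\<close>
      by (simp add: prob_space mult_left_mono)
    finally show "- (Cf * (\<beta> + 2 * Lg\<^sup>2 * C + (norm v)\<^sup>2)) \<le> \<Phi> B v" by simp
  qed
  have V_le: "V v \<le> \<Phi> B v" if "B \<in> \<A>" for B v
    unfolding V_eq by (rule cINF_lower[OF bdd that])
  have le_V: "a \<le> V v" if "\<And>B. B \<in> \<A> \<Longrightarrow> a \<le> \<Phi> B v" for a v
    unfolding V_eq using A that by (intro cINF_greatest) auto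
  have V_y: "V y = \<Phi> A y"
    using assms(20) by (simp add: V_def \<A>_def \<Phi>_def)
  have mid: "V y \<le> (V (y + \<xi>) + V (y - \<xi>)) / 2" for \<xi>
  proof -
    have sum_le: "2 * V y \<le> \<Phi> B (y + \<xi>) + \<Phi> B' (y - \<xi>)" if B: "B \<in> \<A>" "B' \<in> \<A>" for B B'
    proof -
      \<comment> \<open>The weights stay \<open>1/2\<close> and \<open>1 - 1/2\<close> so that the
        control has literally the form in the joint convexity hypothesis.\<close>
      let ?M = "\<lambda>t \<omega>. (1/2) *\<^sub>R B t \<omega> + (1 - 1/2) *\<^sub>R B' t \<omega>"
      have M: "?M \<in> \<A>"
        using B assms(17) unfolding \<A>_def by (intro controls_convex_combination) auto
      have y: "(1/2) *\<^sub>R (y + \<xi>) + (1 - 1/2) *\<^sub>R (y - \<xi>) = y"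
        by (simp add: scaleR_add_right scaleR_diff_right scaleR_half_double flip: scaleR_add_left)
      have "AE \<omega> in M. f (g (X ?M T \<omega>), (1/2) *\<^sub>R (y + \<xi>) + (1 - 1/2) *\<^sub>R (y - \<xi>))
          \<le> 1/2 * f (g (X B T \<omega>), y + \<xi>) + (1 - 1/2) * f (g (X B' T \<omega>), y - \<xi>)"
        by (rule assms(18)[rule_format]) (use B in \<open>auto simp: \<A>_def\<close>)
      then have "\<Phi> ?M y \<le> expectation (\<lambda>\<omega>. 1/2 * f (g (X B T \<omega>), y + \<xi>) + 1/2 * f (g (X B' T \<omega>), y - \<xi>))"
        unfolding y \<Phi>_def using f_int B M
        by (intro integral_mono_AE) auto
      also have "\<dots> = (\<Phi> B (y + \<xi>) + \<Phi> B' (y - \<xi>)) / 2"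
        unfolding \<Phi>_def using f_int B by simp
      finally show ?thesis
        using V_le[OF M, of y] by simp
    qed
    \<comment> \<open>The two infima are taken one at a time: over \<open>B'\<close> with
      \<open>B\<close> fixed, then over \<open>B\<close>.\<close>
    have "2 * V y - \<Phi> B (y + \<xi>) \<le> V (y - \<xi>)" if B: "B \<in> \<A>" for B
    proof (rule le_V)
      fix B' assume "B' \<in> \<A>"
      then show "2 * V y - \<Phi> B (y + \<xi>) \<le> \<Phi> B' (y - \<xi>)"
        using sum_le[OF B, of B'] by linarith
    qed
    then have "2 * V y - V (y - \<xi>) \<le> \<Phi> B (y + \<xi>)" if "B \<in> \<A>" for B
      using that by (fastforce simp: diff_le_eq add.commute)
    then have "2 * V y - V (y - \<xi>) \<le> V (y + \<xi>)"
      by (rule le_V)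
    then show ?thesis by simp
  qed
  define G where "G x = gradient (\<lambda>u. f (x, u)) y" for x
  have G_up: "f (x, y + \<xi>) \<le> f (x, y) + \<xi> \<bullet> G x + 1/2 * m * (norm \<xi>)\<^sup>2" for x \<xi>
    unfolding G_def by (rule semiconcave)
  \<comment> \<open>Convexity of \<open>f\<close> supplies the midpoint inequality for each section,
    so \<open>G x\<close> is its derivative at \<open>y\<close> with a remainder uniform in
    \<open>x\<close>.\<close>
  have G_bound: "\<bar>f (x, y + \<xi>) - f (x, y) - \<xi> \<bullet> G x\<bar> \<le> 1/2 * m * (norm \<xi>)\<^sup>2" for x \<xi>
  proof (rule midpoint_convex_semiconcave_bound[where h = "\<lambda>u. f (x, u)", OF _ G_up])
    fix \<xi>
    have "(1 - 1/2) *\<^sub>R (x, y + \<xi>) + (1/2) *\<^sub>R (x, y - \<xi>) = (x, y)"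
      by (simp add: scaleR_add_right scaleR_diff_right flip: scaleR_add_left)
    then show "f (x, y) \<le> (f (x, y + \<xi>) + f (x, y - \<xi>)) / 2"
      using convex_onD[OF assms(12), of "1/2" "(x, y + \<xi>)" "(x, y - \<xi>)"] by simp
  qed
  \<comment> \<open>Each coordinate is a limit of difference quotients with step
    \<open>1 / Suc n\<close>; \<open>G_bound\<close> gives an error of \<open>m / 2\<close> times
    the step.\<close>
  have G_meas[measurable]: "G \<in> borel_measurable borel"
  proof (subst borel_measurable_euclidean_space, rule ballI)
    fix b :: "real^'m" assume "b \<in> Basis"
    show "(\<lambda>x. G x \<bullet> b) \<in> borel_measurable borel"
    proof (rule borel_measurable_LIMSEQ_real)
      show "(\<lambda>x. real (Suc n) * (f (x, y + (1 / real (Suc n)) *\<^sub>R b) - f (x, y))) \<in> borel_measurable borel" for n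
        by measurable
      fix x
      show "(\<lambda>n. real (Suc n) * (f (x, y + (1 / real (Suc n)) *\<^sub>R b) - f (x, y))) \<longlonglongrightarrow> G x \<bullet> b"
      proof (rule LIM_zero_cancel, rule Lim_null_comparison)
        show "(\<lambda>n. 1/2 * m * (1 / real (Suc n))) \<longlonglongrightarrow> 0"
          using tendsto_mult_left[OF LIMSEQ_Suc[OF lim_1_over_n], of "1/2 * m"] by simp
        show "\<forall>\<^sub>F n in sequentially. norm (real (Suc n) * (f (x, y + (1 / real (Suc n)) *\<^sub>R b) - f (x, y)) - G x \<bullet> b)
            \<le> 1/2 * m * (1 / real (Suc n))"
        proof (intro always_eventually allI)
          fix n
          define N where "N = real (Suc n)"
          have N: "0 < N" by (simp add: N_def)
          have "\<bar>f (x, y + (1 / N) *\<^sub>R b) - f (x, y) - (1 / N) * (G x \<bullet> b)\<bar> \<le> 1/2 * m * (1 / N)\<^sup>2"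
            using G_bound[of x "(1 / N) *\<^sub>R b"] \<open>b \<in> Basis\<close> N by (simp add: inner_commute)
          then have "N * \<bar>f (x, y + (1 / N) *\<^sub>R b) - f (x, y) - (1 / N) * (G x \<bullet> b)\<bar> \<le> N * (1/2 * m * (1 / N)\<^sup>2)"
            using N by (intro mult_left_mono) auto
          also have "N * (1/2 * m * (1 / N)\<^sup>2) = 1/2 * m * (1 / N)"
            using N by (simp add: power2_eq_square)
          also have "N * \<bar>f (x, y + (1 / N) *\<^sub>R b) - f (x, y) - (1 / N) * (G x \<bullet> b)\<bar> =
              \<bar>N * (f (x, y + (1 / N) *\<^sub>R b) - f (x, y) - (1 / N) * (G x \<bullet> b))\<bar>"
            using N by (simp add: abs_mult)
          also have "N * (f (x, y + (1 / N) *\<^sub>R b) - f (x, y) - (1 / N) * (G x \<bullet> b)) =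
              N * (f (x, y + (1 / N) *\<^sub>R b) - f (x, y)) - G x \<bullet> b"
            using N by (simp add: right_diff_distrib)
          finally show "norm (real (Suc n) * (f (x, y + (1 / real (Suc n)) *\<^sub>R b) - f (x, y)) - G x \<bullet> b)
            \<le> 1/2 * m * (1 / real (Suc n))"
            unfolding N_def real_norm_def .
        qed
      qed
    qed
  qed
  have G_norm: "norm (G (g x)) \<le> 2 * Cf * (\<beta> + 2 * Lg\<^sup>2 * (norm x)\<^sup>2 + (norm y + 1)\<^sup>2) + m / 2" for x
  proof -
    \<comment> \<open>A unit step against the gradient: semiconcavity then bounds
      \<open>norm (G (g x))\<close> by values of \<open>f\<close> at \<open>y\<close> and
      \<open>y + \<xi>\<close>, which explains \<open>norm y + 1\<close>. If the gradient is 0, so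
      is \<open>\<xi>\<close>.\<close>
    define \<xi> where "\<xi> = - sgn (G (g x))"
    have \<xi>: "norm \<xi> \<le> 1" "\<xi> \<bullet> G (g x) = - norm (G (g x))"
      by (cases "G (g x) = 0"; simp add: \<xi>_def sgn_div_norm power2_norm_eq_inner[symmetric] power2_eq_square)+
    have le: "bd v x \<le> Cf * (\<beta> + 2 * Lg\<^sup>2 * (norm x)\<^sup>2 + (norm y + 1)\<^sup>2)" if "norm v \<le> norm y + 1" for v
      unfolding bd_def using that \<open>0 \<le> Cf\<close> by (intro mult_left_mono add_left_mono power_mono) auto
    have "1/2 * m * (norm \<xi>)\<^sup>2 \<le> 1/2 * m * 1"
      using m \<xi>(1) by (intro mult_left_mono) (auto simp: power_le_one)
    then have "norm (G (g x)) \<le> \<bar>f (g x, y)\<bar> + \<bar>f (g x, y + \<xi>)\<bar> + m / 2"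
      using G_up[of "g x" \<xi>] \<xi>(2) by linarith
    also have "\<dots> \<le> bd y x + bd (y + \<xi>) x + m / 2"
      by (intro add_mono f_bd) auto
    also have "\<dots> \<le> 2 * Cf * (\<beta> + 2 * Lg\<^sup>2 * (norm x)\<^sup>2 + (norm y + 1)\<^sup>2) + m / 2"
      using le[of y] le[of "y + \<xi>"] norm_triangle_ineq[of y \<xi>] \<xi>(1) by simp
    finally show ?thesis .
  qed
  have G_int: "integrable M (\<lambda>\<omega>. G (g (X A T \<omega>)))"
  proof (rule Bochner_Integration.integrable_bound)
    show "integrable M (\<lambda>\<omega>. 2 * Cf * (\<beta> + 2 * Lg\<^sup>2 * (norm (X A T \<omega>))\<^sup>2 + (norm y + 1)\<^sup>2) + m / 2)"
      using X_int[OF A] by auto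
    show "(\<lambda>\<omega>. G (g (X A T \<omega>))) \<in> borel_measurable M"
      using X_meas[OF A] by measurable
  qed (use G_norm in \<open>auto intro!: AE_I2 intro: order.trans[OF _ abs_ge_self]\<close>)
  have up: "V (y + \<xi>) \<le> V y + \<xi> \<bullet> expectation (\<lambda>\<omega>. G (g (X A T \<omega>))) + 1/2 * m * (norm \<xi>)\<^sup>2" for \<xi>
  proof -
    have "V (y + \<xi>) \<le> \<Phi> A (y + \<xi>)" by (rule V_le[OF A])
    also have "\<dots> \<le> expectation (\<lambda>\<omega>. f (g (X A T \<omega>), y) + \<xi> \<bullet> G (g (X A T \<omega>)) + 1/2 * m * (norm \<xi>)\<^sup>2)"
      unfolding \<Phi>_def using f_int[OF A] G_int by (intro integral_mono G_up) auto
    also have "\<dots> = \<Phi> A y + \<xi> \<bullet> expectation (\<lambda>\<omega>. G (g (X A T \<omega>))) + 1/2 * m * (norm \<xi>)\<^sup>2"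
      unfolding \<Phi>_def using f_int[OF A] G_int by (simp add: prob_space)
    finally show ?thesis unfolding V_y .
  qed
  have "GDERIV V y :> expectation (\<lambda>\<omega>. G (g (X A T \<omega>)))"
    by (rule midpoint_convex_semiconcave_GDERIV[OF mid up])
  with G_int show ?thesis
    unfolding G_def V_def \<A>_def by simp
qed

end
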